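(* Fix $r\in\{3,4,\ldots,9\}$ and an integer $d\ge 2r-2$. There exists a matrix $\mathcal{M}_r$ such that: (a) the maximal minors of $\mathcal{M}_r$ form a Gröbner basis (with respect to the lexicographic term order on $\mathbb{C}[t_0,\ldots,t_d]$ with $t_0>t_1>\cdots>t_d$) for the prime ideal in $\mathbb{C}[t_0,\ldots,t_d]$ of the fradeco variety $\mathcal{T}_{r,2,d}\subset\mathbb{P}^d$; (b) $\mathcal{M}_r$ has $r-1$ rows and $d-r+1$ columns, and its entries are linear forms in $t_0,\ldots,t_d$; (c) each column of $\mathcal{M}_r$ involves $r+1$ of the unknowns $t_i$, and the columns are identical up to index shifts. These matrices can be chosen as follows. For $j=0,1,\ldots,d-r$, column $j+1$ of $\mathcal{M}_r$ is obtained from the first column by replacing every $t_i$ by $t_{i+j}$, and the first columns are: $\mathcal{M}_3$: $(t_0-3t_2,\ 3t_1-t_3)^T$; $\mathcal{M}_4$: $(t_0+t_4,\ t_1-t_3,\ t_2)^T$; $\mathcal{M}_5$: $(t_0+5t_2,\ t_1-3t_3,\ 3t_2-t_4,\ 5t_3+t_5)^T$; $\mathcal{M}_6$: $(t_0+3t_2,\ t_1+t_5,\ t_2-t_4,\ t_3,\ 3t_4+t_6)^T$; $\mathcal{M}_7$: $(3t_0+7t_2,\ t_1+5t_3,\ t_2-3t_4,\ 3t_3-t_5,\ 5t_4+t_6,\ 7t_5+3t_7)^T$; $\mathcal{M}_8$: $(t_0+2t_2,\ t_1+3t_3,\ t_4,\ t_3-t_5,\ t_2+t_6,\ 3t_5+t_7,\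 2t_6+t_8)^T$; $\mathcal{M}_9$: $(5t_0+9t_2,\ 3t_1+7t_3,\ t_2+5t_4,\ t_3-3t_5,\ 3t_4-t_6,\ 5t_5+t_7,\ 7t_6+3t_8,\ 9t_7+5t_9)^T$.
   Context: For integers $r\ge n\ge 1$, the funtf variety (finite unit norm tight frames) $\mathcal{F}_{r,n}\subset\mathbb{C}^{n\times r}$ is the set of complex $n\times r$ matrices $V=(v_{ij})$ with columns $\mathbf{v}_1,\ldots,\mathbf{v}_r\in\mathbb{C}^n$ such that $V V^T=\frac{r}{n}\,\mathrm{Id}_n$ and $\sum_{i=1}^n v_{ij}^2=1$ for $j=1,\ldots,r$ (plain transpose, no complex conjugation). For a positive integer $d$, the fradeco variety $\mathcal{T}_{r,n,d}\subset\mathbb{P}(\mathrm{Sym}_d(\mathbb{C}^n))$ is the Zariski closure of the set of (classes of nonzero) symmetric tensors of the form $\sum_{j=1}^r\lambda_j\mathbf{v}_j^{\otimes d}$ with $V=(\mathbf{v}_1,\ldots,\mathbf{v}_r)\in\mathcal{F}_{r,n}$ and $\lambda_1,\ldots,\lambda_r\in\mathbb{C}$. For $n=2$, $(t_0:\cdots:t_d)$ are the homogeneous coordinates on $\mathbb{P}^d=\mathbb{P}(\mathrm{Sym}_d(\mathbb{C}^2))$, where $t_i$ is the entry of the symmetric tensor indexed by $i$ ones and $d-i$ twos. So $\sum_j\lambda_j\mathbf{v}_j^{\otimes d}$ has coordinates $t_i=\sum_j\lambda_j v_{1j}^i v_{2j}^{d-i}$. The prime ideal of $\mathcal{T}_{r,2,d}$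 is the homogeneous ideal of all polynomials in $\mathbb{C}[t_0,\ldots,t_d]$ vanishing on it. *)

theory Defs
  imports
    Complex_Main
    "HOL-Library.Poly_Mapping"
    "HOL-Algebra.Ideal"
    "Jordan_Normal_Form.Determinant"
    "Jordan_Normal_Form.DL_Submatrix"
begin

text \<open>These constants are hidden by the library, so short names are restored here.\<close>

abbreviation "single \<equiv> Poly_Mapping.single"
abbreviation "lookup \<equiv> Poly_Mapping.lookup"
abbreviation "keys \<equiv> Poly_Mapping.keys"

section \<open>The polynomial ring in the unknowns \<open>t\<^sub>0, \<dots>, t\<^sub>d\<close>\<close>

text \<open>
  A monomial is its exponent vector, a finitely supported function from indices of unknowns to
  naturals; a polynomial maps finitely many monomials to nonzero coefficients. The type contains
  polynomials in all \<open>t\<^sub>0, t\<^sub>1, \<dots>\<close>; the ring in \<open>t\<^sub>0, \<dots>, t\<^sub>d\<close> is the subring \<open>poly_ring d\<close>.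
\<close>

type_synonym cpoly = "(nat \<Rightarrow>\<^sub>0 nat) \<Rightarrow>\<^sub>0 complex"

definition tvar :: "nat \<Rightarrow> cpoly" where
  "tvar i = single (single i 1) 1"

definition unknowns :: "cpoly \<Rightarrow> nat set" where
  "unknowns f = (\<Union>m\<in>keys f. keys m)"

definition poly_ring :: "nat \<Rightarrow> cpoly ring" where
  "poly_ring d = \<lparr>carrier = {f. unknowns f \<subseteq> {..d}}, monoid.mult = (*), one = 1, zero = 0, add = (+)\<rparr>"

lemma cring_poly_ring: "cring (poly_ring d)"
proof -
  have add: "unknowns (f + g) \<subseteq> {..d}"
    if "unknowns f \<subseteq> {..d}" "unknowns g \<subseteq> {..d}" for f g
    using that Poly_Mapping.keys_add[of f g] unfolding unknowns_def by blast
  have mult: "unknowns (f * g) \<subseteq> {..d}"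
    if f: "unknowns f \<subseteq> {..d}" and g: "unknowns g \<subseteq> {..d}" for f g
  proof -
    have "keys m \<subseteq> {..d}" if "m \<in> keys (f * g)" for m
    proof -
      obtain a b where "m = a + b" "a \<in> keys f" "b \<in> keys g"
        using \<open>m \<in> keys (f * g)\<close> keys_mult[of f g] by blast
      then show ?thesis
        using f g Poly_Mapping.keys_add[of a b] unfolding unknowns_def by blast
    qed
    then show ?thesis unfolding unknowns_def by blast
  qed
  have one: "unknowns 1 \<subseteq> {..d}" and zero: "unknowns 0 \<subseteq> {..d}"
    by (simp_all add: unknowns_def)
  have uminus: "unknowns (- f) \<subseteq> {..d}" if "unknowns f \<subseteq> {..d}" for f
    using that by (simp add: unknowns_def)
  show ?thesis
    apply (rule cringI)
      apply (rule abelian_groupI)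
           apply (auto simp: poly_ring_def add zero algebra_simps)[5]
      apply (metis (mono_tags, lifting) add.left_inverse mem_Collect_eq partial_object.select_convs(1)
        poly_ring_def ring.simps(1,2) uminus)
     apply (unfold_locales; simp add: poly_ring_def mult one algebra_simps)
    apply (simp add: poly_ring_def algebra_simps)
    done
qed

definition homogeneous :: "nat \<Rightarrow> cpoly \<Rightarrow> bool" where
  "homogeneous k f \<longleftrightarrow> (\<forall>m\<in>keys f. (\<Sum>i\<in>keys m. lookup m i) = k)"

definition linear_form :: "nat \<Rightarrow> cpoly \<Rightarrow> bool" where
  "linear_form d f \<longleftrightarrow> f \<in> carrier (poly_ring d) \<and> homogeneous 1 f"

definition eval_at :: "cpoly \<Rightarrow> complex vec \<Rightarrow> complex" where
  "eval_at f v = (\<Sum>m\<in>keys f. lookup f m * (\<Prod>i\<in>keys m. (v $ i) ^ lookup m i))"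

text \<open>Replacing every \<open>t\<^sub>i\<close> by \<open>t\<^sub>i\<^sub>+\<^sub>j\<close>.\<close>

definition index_shift :: "nat \<Rightarrow> cpoly \<Rightarrow> cpoly" where
  "index_shift j f =
    (\<Sum>m\<in>keys f. single 0 (lookup f m) * (\<Prod>i\<in>keys m. tvar (i + j) ^ lookup m i))"


section \<open>Lexicographic Groebner bases\<close>

text \<open>
  The library order on \<^typ>\<open>nat \<Rightarrow>\<^sub>0 nat\<close> compares exponents at the smallest index where they
  differ (see \<open>lex_order_iff\<close> below), so it is the lexicographic term order with
  \<open>t\<^sub>0 > t\<^sub>1 > \<dots> > t\<^sub>d\<close>.
\<close>

lemma lex_order_iff:
  fixes m m' :: "nat \<Rightarrow>\<^sub>0 nat"
  shows "m < m' \<longleftrightarrow> (\<exists>k. lookup m k < lookup m' k \<and> (\<forall>k'<k. lookup m k' = lookup m' k'))"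
  by (simp add: less_poly_mapping.rep_eq less_fun_def)

definition initial_monomial :: "cpoly \<Rightarrow> cpoly" where
  "initial_monomial f = single (Max (keys f)) 1"

definition initial_ideal :: "nat \<Rightarrow> cpoly set \<Rightarrow> cpoly set" where
  "initial_ideal d F = genideal (poly_ring d) {initial_monomial f | f. f \<in> F \<and> f \<noteq> 0}"

definition is_groebner_basis :: "nat \<Rightarrow> cpoly set \<Rightarrow> cpoly set \<Rightarrow> bool" where
  "is_groebner_basis d G I \<longleftrightarrow> finite G \<and> G \<subseteq> I \<and> initial_ideal d G = initial_ideal d I"

definition maximal_minors :: "cpoly mat \<Rightarrow> cpoly set" where
  "maximal_minors M =
    {det (submatrix M UNIV J) | J. J \<subseteq> {..<dim_col M} \<and> card J = dim_row M}"


section \<open>Zariski closure in projective space\<close>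

text \<open>A point of \<open>\<P>\<^sup>d\<close> is the set of all its vectors of homogeneous coordinates.\<close>

definition proj_point :: "complex vec \<Rightarrow> complex vec set" where
  "proj_point v = {c \<cdot>\<^sub>v v | c. c \<noteq> 0}"

definition proj_space :: "nat \<Rightarrow> complex vec set set" where
  "proj_space d = proj_point ` (carrier_vec (d + 1) - {0\<^sub>v (d + 1)})"

text \<open>
  Vanishing for all choices of homogeneous coordinates. For a polynomial that is not homogeneous
  this says that all its homogeneous components vanish at the point.
\<close>

definition vanishes_at :: "cpoly \<Rightarrow> complex vec set \<Rightarrow> bool" where
  "vanishes_at f P \<longleftrightarrow> (\<forall>v\<in>P. eval_at f v = 0)"

definition zariski_closed :: "nat \<Rightarrow> complex vec set set \<Rightarrow> bool" where
  "zariski_closed d Z \<longleftrightarrow>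
    (\<exists>F \<subseteq> {f \<in> carrier (poly_ring d). \<exists>k. homogeneous k f}.
       Z = {P \<in> proj_space d. \<forall>f\<in>F. vanishes_at f P})"

definition vanishing_ideal :: "nat \<Rightarrow> complex vec set set \<Rightarrow> cpoly set" where
  "vanishing_ideal d Z = {f \<in> carrier (poly_ring d). \<forall>P\<in>Z. vanishes_at f P}"


section \<open>Frames and fradeco varieties\<close>

definition funtf_variety :: "nat \<Rightarrow> nat \<Rightarrow> complex mat set" where
  "funtf_variety r n = {V \<in> carrier_mat n r.
     V * transpose_mat V = (of_nat r / of_nat n) \<cdot>\<^sub>m 1\<^sub>m n \<and>
     (\<forall>j<r. (\<Sum>i<n. (V $$ (i, j))\<^sup>2) = 1)}"

text \<open>
  The tensor \<open>\<Sum>\<^sub>j \<lambda>\<^sub>j v\<^sub>j\<^sup>\<otimes>\<^sup>d\<close>, for \<open>v\<^sub>j\<close> the columns of \<open>V\<close>, as the function that gives the entry at an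
  index list \<open>[k\<^sub>1, \<dots>, k\<^sub>d]\<close>. Indices start at 0.
\<close>

definition frame_tensor :: "complex mat \<Rightarrow> (nat \<Rightarrow> complex) \<Rightarrow> nat list \<Rightarrow> complex" where
  "frame_tensor V lam ks = (\<Sum>j<dim_col V. lam j * (\<Prod>k\<leftarrow>ks. V $$ (k, j)))"

text \<open>
  Coordinates on \<open>Sym\<^sub>d(\<complex>\<^sup>2)\<close>: \<open>t\<^sub>i\<close> is the entry indexed by \<open>i\<close> ones and \<open>d - i\<close> twos, which
  are 0 and 1 in the zero-based indexing.
\<close>

definition binary_coords :: "nat \<Rightarrow> (nat list \<Rightarrow> complex) \<Rightarrow> complex vec" where
  "binary_coords d T = vec (d + 1) (\<lambda>i. T (replicate i 0 @ replicate (d - i) 1))"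

lemma binary_coords_frame_tensor:
  assumes "V \<in> carrier_mat 2 r" "i \<le> d"
  shows "binary_coords d (frame_tensor V lam) $ i =
    (\<Sum>j<r. lam j * (V $$ (0, j)) ^ i * (V $$ (1, j)) ^ (d - i))"
  using assms by (auto simp: binary_coords_def frame_tensor_def mult.assoc map_replicate_const
      prod_list_replicate)

text \<open>The variety \<open>\<T>\<^sub>r\<^sub>,\<^sub>2\<^sub>,\<^sub>d\<close>.\<close>

definition fradeco_variety :: "nat \<Rightarrow> nat \<Rightarrow> complex vec set set" where
  "fradeco_variety r d = zariski_closed d hull
    {proj_point (binary_coords d (frame_tensor V lam)) | V lam.
       V \<in> funtf_variety r 2 \<and> binary_coords d (frame_tensor V lam) \<noteq> 0\<^sub>v (d + 1)}"


section \<open>The matrices\<close>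

definition first_column :: "nat \<Rightarrow> cpoly list" where
  "first_column r =
    (if r = 3 then
       [tvar 0 - 3 * tvar 2,
        3 * tvar 1 - tvar 3]
     else if r = 4 then
       [tvar 0 + tvar 4,
        tvar 1 - tvar 3,
        tvar 2]
     else if r = 5 then
       [tvar 0 + 5 * tvar 2,
        tvar 1 - 3 * tvar 3,
        3 * tvar 2 - tvar 4,
        5 * tvar 3 + tvar 5]
     else if r = 6 then
       [tvar 0 + 3 * tvar 2,
        tvar 1 + tvar 5,
        tvar 2 - tvar 4,
        tvar 3,
        3 * tvar 4 + tvar 6]
     else if r = 7 then
       [3 * tvar 0 + 7 * tvar 2,
        tvar 1 + 5 * tvar 3,
        tvar 2 - 3 * tvar 4,
        3 * tvar 3 - tvar 5,
        5 * tvar 4 + tvar 6,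
        7 * tvar 5 + 3 * tvar 7]
     else if r = 8 then
       [tvar 0 + 2 * tvar 2,
        tvar 1 + 3 * tvar 3,
        tvar 4,
        tvar 3 - tvar 5,
        tvar 2 + tvar 6,
        3 * tvar 5 + tvar 7,
        2 * tvar 6 + tvar 8]
     else if r = 9 then
       [5 * tvar 0 + 9 * tvar 2,
        3 * tvar 1 + 7 * tvar 3,
        tvar 2 + 5 * tvar 4,
        tvar 3 - 3 * tvar 5,
        3 * tvar 4 - tvar 6,
        5 * tvar 5 + tvar 7,
        7 * tvar 6 + 3 * tvar 8,
        9 * tvar 7 + 5 * tvar 9]
     else [])"

definition fradeco_matrix :: "nat \<Rightarrow> nat \<Rightarrow> cpoly mat" where
  "fradeco_matrix r d =
    mat (r - 1) (d - r + 1) (\<lambda>(i, j). index_shift j (first_column r ! i))"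

end

theory Submission
  imports Defs
begin

text \<open>
  A frame vector \<open>(x\<^sub>j, y\<^sub>j)\<close> is a root of \<open>q = \<Prod>\<^sub>j (y\<^sub>j X - x\<^sub>j)\<close>, so \<open>q\<close> annihilates the tensor, and
  tightness of the frame says exactly that \<open>2 z q' - r q\<close> vanishes at \<open>z = \<plusminus>\<i>\<close>. The rows of the matrix
  span the coefficient vectors of degree \<open>r\<close> with this property, hence its rank drops on the variety.
  The leading monomial of the minor with columns \<open>j\<^sub>0 < j\<^sub>1 < \<dots>\<close> is the product of the \<open>t\<close> with indices
  \<open>j\<^sub>k + k\<close>, that is, of \<open>r - 1\<close> unknowns among \<open>t\<^sub>0, \<dots>, t\<^bsub>d-2\<^esub>\<close> no two of which are adjacent.

  Conversely, a monomial divisible by no such product involves, apart from \<open>t\<^bsub>d-1\<^esub>\<close> and \<open>t\<^sub>d\<close>, only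
  \<open>r - 2\<close> pairs of adjacent unknowns. Suppose that it leads a polynomial \<open>f\<close> of the ideal, and take
  rapidly decreasing convex weights \<open>w\<close> that induce the lexicographic order on the monomials of \<open>f\<close>.
  The tangent lines of \<open>w\<close> at these pairs are the exponents of \<open>r - 2\<close> geometric sequences whose sum
  has \<open>t\<^sub>i\<close> of order at most \<open>exp (L w\<^sub>i)\<close>, with equality at the pairs. Their slopes tend to \<open>0\<close>,
  and two further directions complete them to a tight frame and give \<open>t\<^bsub>d-1\<^esub>\<close> and \<open>t\<^sub>d\<close> the right
  order. Along this curve of tensors the leading term of \<open>f\<close> dominates as \<open>L\<close> tends to infinity,
  so \<open>f\<close> cannot vanish.
\<close>

section \<open>Evaluation and linear forms\<close>

definition monomial_at :: "(nat \<Rightarrow>\<^sub>0 nat) \<Rightarrow> (nat \<Rightarrow> complex) \<Rightarrow> complex" where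
  "monomial_at m x = (\<Prod>i\<in>keys m. x i ^ lookup m i)"

lemma monomial_at_superset:
  assumes "finite A" "keys m \<subseteq> A"
  shows "monomial_at m x = (\<Prod>i\<in>A. x i ^ lookup m i)"
  unfolding monomial_at_def using assms
  by (intro prod.mono_neutral_left) (auto simp: in_keys_iff)

lemma monomial_at_add: "monomial_at (m + m') x = monomial_at m x * monomial_at m' x"
proof -
  let ?A = "keys m \<union> keys m'"
  have "monomial_at (m + m') x = (\<Prod>i\<in>?A. x i ^ lookup (m + m') i)"
    by (rule monomial_at_superset) (auto dest!: subsetD[OF Poly_Mapping.keys_add])
  also have "\<dots> = (\<Prod>i\<in>?A. x i ^ lookup m i) * (\<Prod>i\<in>?A. x i ^ lookup m' i)"
    by (simp add: lookup_add power_add prod.distrib)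
  also have "\<dots> = monomial_at m x * monomial_at m' x"
    by (simp add: monomial_at_superset[of ?A])
  finally show ?thesis .
qed

lemma monomial_at_0 [simp]: "monomial_at 0 x = 1"
  by (simp add: monomial_at_def)

text \<open>Cancellation can make the support of a sum smaller than the union of the supports.
  Missing monomials have coefficient 0, so all sums may be taken over one common finite set.\<close>

lemma eval_at_superset:
  assumes "finite A" "keys f \<subseteq> A"
  shows "eval_at f v = (\<Sum>m\<in>A. lookup f m * monomial_at m (($) v))"
  unfolding eval_at_def monomial_at_def[symmetric] using assms
  by (intro sum.mono_neutral_left) (auto simp: in_keys_iff)

lemma eval_at_single: "eval_at (single m c) v = c * monomial_at m (($) v)"
  by (subst eval_at_superset[of "{m}"]) auto

lemma eval_at_add: "eval_at (f + g) v = eval_at f v + eval_at g v"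
proof -
  let ?A = "keys f \<union> keys g"
  have "eval_at (f + g) v = (\<Sum>m\<in>?A. lookup (f + g) m * monomial_at m (($) v))"
    by (rule eval_at_superset) (auto dest!: subsetD[OF Poly_Mapping.keys_add])
  then show ?thesis
    by (simp add: lookup_add algebra_simps sum.distrib eval_at_superset[of ?A])
qed

lemma eval_at_0 [simp]: "eval_at 0 v = 0"
  by (simp add: eval_at_def)

lemma eval_at_sum: "eval_at (sum f A) v = (\<Sum>a\<in>A. eval_at (f a) v)"
  by (induction A rule: infinite_finite_induct) (auto simp: eval_at_add)

lemma sum_monomials: "(\<Sum>m\<in>keys f. single m (lookup f m)) = f"
proof (rule poly_mapping_eqI)
  fix k
  have "lookup (\<Sum>m\<in>keys f. single m (lookup f m)) k
      = (\<Sum>m\<in>keys f. if m = k then lookup f m else 0)"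
    by (auto simp: lookup_sum lookup_single when_def intro!: sum.cong)
  then show "lookup (\<Sum>m\<in>keys f. single m (lookup f m)) k = lookup f k"
    by (auto simp: in_keys_iff)
qed

lemma eval_at_mult: "eval_at (f * g) v = eval_at f v * eval_at g v"
proof -
  have "f * g = (\<Sum>m\<in>keys f. \<Sum>m'\<in>keys g. single (m + m') (lookup f m * lookup g m'))"
    by (subst (1) sum_monomials[of f, symmetric], subst (1) sum_monomials[of g, symmetric])
      (simp add: sum_product mult_single)
  then have "eval_at (f * g) v = (\<Sum>m\<in>keys f. \<Sum>m'\<in>keys g.
      (lookup f m * lookup g m') * (monomial_at m (($) v) * monomial_at m' (($) v)))"
    by (simp add: eval_at_sum eval_at_single monomial_at_add)
  also have "\<dots> = eval_at f v * eval_at g v"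
    by (simp add: eval_at_superset[of "keys f"] eval_at_superset[of "keys g"] sum_product mult_ac)
  finally show ?thesis .
qed

lemma comm_ring_hom_eval_at: "comm_ring_hom (\<lambda>f. eval_at f v)"
proof
  show "eval_at 1 v = 1" using eval_at_single[of 0 1 v] by simp
qed (simp_all add: eval_at_add eval_at_mult)

section \<open>Closure of the polynomial ring, and homogeneity of determinants\<close>

lemma ring_sum_closed:
  assumes "\<And>a. a \<in> A \<Longrightarrow> f a \<in> carrier (poly_ring d)"
  shows "sum f A \<in> carrier (poly_ring d)"
proof -
  interpret cring "poly_ring d" by (rule cring_poly_ring)
  show ?thesis using assms
  proof (induction A rule: infinite_finite_induct)
    case (insert a A)
    then have "f a \<oplus>\<^bsub>poly_ring d\<^esub> sum f A \<in> carrier (poly_ring d)" by blast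
    then show ?case using insert by (simp add: poly_ring_def)
  qed (use zero_closed in \<open>simp_all add: poly_ring_def\<close>)
qed

lemma ring_mult_closed:
  assumes "f \<in> carrier (poly_ring d)" "g \<in> carrier (poly_ring d)"
  shows "f * g \<in> carrier (poly_ring d)"
proof -
  interpret cring "poly_ring d" by (rule cring_poly_ring)
  show ?thesis using m_closed[OF assms] by (simp add: poly_ring_def)
qed

lemma ring_prod_closed:
  assumes "\<And>a. a \<in> A \<Longrightarrow> f a \<in> carrier (poly_ring d)"
  shows "prod f A \<in> carrier (poly_ring d)"
  using assms
proof (induction A rule: infinite_finite_induct)
  case (insert a A)
  then show ?case by (simp add: ring_mult_closed)
qed (simp_all add: poly_ring_def unknowns_def)

lemma unknowns_single: "unknowns (single m c) = (if c = 0 then {} else keys m)"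
  by (simp add: unknowns_def)

text \<open>The sign in a determinant is an integer embedded in \<open>cpoly\<close>. Written as a
  constant monomial, it has a visible support and degree.\<close>

lemma signof_single: "(signof p :: cpoly) = single 0 (signof p)"
  by (simp only: single_of_int)

lemma ring_det_closed:
  assumes "\<And>i j. i < dim_row A \<Longrightarrow> j < dim_col A \<Longrightarrow> A $$ (i, j) \<in> carrier (poly_ring d)"
  shows "det A \<in> carrier (poly_ring d)"
proof (cases "dim_row A = dim_col A")
  case True
  have "signof p \<in> carrier (poly_ring d)" for p
    unfolding signof_single poly_ring_def by (simp add: unknowns_single del: single_of_int)
  moreover have "A $$ (i, p i) \<in> carrier (poly_ring d)"
    if "i < dim_row A" "p permutes {0..<dim_row A}" for i p
    using that True permutes_in_image[of p "{0..<dim_row A}" i] by (intro assms) auto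
  ultimately show ?thesis
    unfolding det_def using True by (auto intro!: ring_sum_closed ring_mult_closed ring_prod_closed)
next
  case False
  then show ?thesis by (simp add: det_def poly_ring_def unknowns_def)
qed

lemma homogeneousI:
  assumes "\<And>m. m \<in> keys f \<Longrightarrow> (\<Sum>i\<in>keys m. lookup m i) = k"
  shows "homogeneous k f"
  using assms by (simp add: homogeneous_def)

lemma total_degree_add:
  fixes m m' :: "nat \<Rightarrow>\<^sub>0 nat"
  shows "(\<Sum>i\<in>keys (m + m'). lookup (m + m') i) = (\<Sum>i\<in>keys m. lookup m i) + (\<Sum>i\<in>keys m'. lookup m' i)"
proof -
  let ?A = "keys m \<union> keys m'"
  have *: "(\<Sum>i\<in>keys n. lookup n i) = (\<Sum>i\<in>?A. lookup n i)" if "keys n \<subseteq> ?A" for n :: "nat \<Rightarrow>\<^sub>0 nat"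
    using that by (intro sum.mono_neutral_left) (auto simp: in_keys_iff)
  show ?thesis
    by (subst (1 2 3) *) (auto simp: lookup_add sum.distrib dest!: subsetD[OF Poly_Mapping.keys_add])
qed

lemma homogeneous_mult:
  assumes "homogeneous k f" "homogeneous l g"
  shows "homogeneous (k + l) (f * g)"
proof (rule homogeneousI)
  fix m assume "m \<in> keys (f * g)"
  then obtain a b where "m = a + b" "a \<in> keys f" "b \<in> keys g"
    using keys_mult[of f g] by blast
  with assms show "(\<Sum>i\<in>keys m. lookup m i) = k + l"
    by (simp add: total_degree_add homogeneous_def)
qed

lemma homogeneous_sum:
  assumes "\<And>a. a \<in> A \<Longrightarrow> homogeneous k (f a)"
  shows "homogeneous k (sum f A)"
proof (rule homogeneousI)
  fix m assume "m \<in> keys (sum f A)"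
  then obtain a where "a \<in> A" "m \<in> keys (f a)" using Poly_Mapping.keys_sum[of f A] by blast
  with assms show "(\<Sum>i\<in>keys m. lookup m i) = k" by (auto simp: homogeneous_def)
qed

lemma homogeneous_prod:
  assumes "finite A" "\<And>a. a \<in> A \<Longrightarrow> homogeneous 1 (f a)"
  shows "homogeneous (card A) (prod f A)"
  using assms
proof (induction A rule: finite_induct)
  case empty
  then show ?case by (simp add: homogeneous_def)
next
  case (insert a A)
  then show ?case using homogeneous_mult[of 1 "f a" "card A" "prod f A"] by simp
qed

lemma homogeneous_det:
  assumes "A \<in> carrier_mat n n" "\<And>i j. i < n \<Longrightarrow> j < n \<Longrightarrow> homogeneous 1 (A $$ (i, j))"
  shows "homogeneous n (det A)"
  unfolding det_def'[OF assms(1)]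
proof (rule homogeneous_sum)
  fix p assume p: "p \<in> {p. p permutes {0..<n}}"
  have "homogeneous 0 (signof p :: cpoly)"
    unfolding signof_single by (simp add: homogeneous_def del: single_of_int)
  moreover have "homogeneous (card {0..<n}) (\<Prod>i=0..<n. A $$ (i, p i))"
    using p permutes_in_image[of p "{0..<n}"] by (intro homogeneous_prod assms(2)) auto
  ultimately show "homogeneous n (signof p * (\<Prod>i=0..<n. A $$ (i, p i)))"
    using homogeneous_mult[of 0 _ n] by simp
qed

section \<open>Index shifts and the linear forms in the matrices\<close>

lemma index_shift_superset:
  assumes "finite A" "keys f \<subseteq> A"
  shows "index_shift j f =
    (\<Sum>m\<in>A. single 0 (lookup f m) * (\<Prod>i\<in>keys m. tvar (i + j) ^ lookup m i))"
  unfolding index_shift_def using assms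
  by (intro sum.mono_neutral_left) (auto simp: in_keys_iff)

lemma index_shift_add: "index_shift j (f + g) = index_shift j f + index_shift j g"
proof -
  let ?A = "keys f \<union> keys g"
  have "index_shift j (f + g)
      = (\<Sum>m\<in>?A. single 0 (lookup (f + g) m) * (\<Prod>i\<in>keys m. tvar (i + j) ^ lookup m i))"
    by (rule index_shift_superset) (auto dest!: subsetD[OF Poly_Mapping.keys_add])
  then show ?thesis
    by (simp add: lookup_add single_add algebra_simps sum.distrib index_shift_superset[of ?A])
qed

lemma index_shift_0 [simp]: "index_shift j 0 = 0"
  by (simp add: index_shift_def)

lemma index_shift_sum: "index_shift j (sum f A) = (\<Sum>a\<in>A. index_shift j (f a))"
  by (induction A rule: infinite_finite_induct) (auto simp: index_shift_add)

lemma index_shift_single: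
  "index_shift j (single (single i 1) c) = single (single (i + j) 1) c"
  by (subst index_shift_superset[of "{single i 1}"]) (auto simp: tvar_def mult_single)

text \<open>The common shape of all matrix entries: the row determines the coefficient vector
  \<open>a\<close>, the column the shift \<open>j\<close>.\<close>

definition shifted_form :: "(nat \<Rightarrow> complex) \<Rightarrow> nat \<Rightarrow> nat \<Rightarrow> cpoly" where
  "shifted_form a r j = (\<Sum>l\<le>r. single (single (l + j) 1) (a l))"

lemma index_shift_shifted_form: "index_shift j (shifted_form a r i) = shifted_form a r (i + j)"
  by (simp add: shifted_form_def index_shift_sum index_shift_single[simplified] add.assoc)

lemma single_index_eq_iff: "single i (1::nat) = single j 1 \<longleftrightarrow> i = j"
  by (metis lookup_single_eq lookup_single_not_eq one_neq_zero)

lemma lookup_shifted_form: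
  "lookup (shifted_form a r j) (single i 1) = (if j \<le> i \<and> i \<le> r + j then a (i - j) else 0)"
proof -
  have "lookup (shifted_form a r j) (single i 1) = (\<Sum>l\<le>r. if l + j = i then a l else 0)"
    unfolding shifted_form_def lookup_sum lookup_single single_index_eq_iff when_def ..
  also have "\<dots> = (\<Sum>l\<le>r. if l = i - j \<and> j \<le> i then a l else 0)"
    by (intro sum.cong) auto
  finally show ?thesis by (cases "j \<le> i") auto
qed

lemma keys_shifted_form: "keys (shifted_form a r j) \<subseteq> (\<lambda>l. single (l + j) 1) ` {l. l \<le> r \<and> a l \<noteq> 0}"
proof -
  have "keys (shifted_form a r j) \<subseteq> (\<Union>l\<in>{..r}. keys (single (single (l + j) (1::nat)) (a l)))"
    unfolding shifted_form_def by (rule Poly_Mapping.keys_sum)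
  then show ?thesis by (auto split: if_splits)
qed

lemma unknowns_shifted_form: "unknowns (shifted_form a r j) = (\<lambda>l. l + j) ` {l. l \<le> r \<and> a l \<noteq> 0}"
proof
  show "unknowns (shifted_form a r j) \<subseteq> (\<lambda>l. l + j) ` {l. l \<le> r \<and> a l \<noteq> 0}"
    using keys_shifted_form[of a r j] by (fastforce simp: unknowns_def)
  show "(\<lambda>l. l + j) ` {l. l \<le> r \<and> a l \<noteq> 0} \<subseteq> unknowns (shifted_form a r j)"
  proof clarify
    fix l assume "l \<le> r" "a l \<noteq> 0"
    then have "single (l + j) 1 \<in> keys (shifted_form a r j)"
      unfolding in_keys_iff lookup_shifted_form by simp
    then show "l + j \<in> unknowns (shifted_form a r j)"
      by (force simp: unknowns_def)
  qed
qed

lemma homogeneous_shifted_form: "homogeneous 1 (shifted_form a r j)"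
  by (rule homogeneousI) (use keys_shifted_form[of a r j] in auto)

lemma eval_shifted_form: "eval_at (shifted_form a r j) v = (\<Sum>l\<le>r. a l * v $ (l + j))"
  by (simp add: shifted_form_def eval_at_sum eval_at_single monomial_at_def)

section \<open>Leading monomials of determinants\<close>

text \<open>The coefficient \<open>c\<close> may be 0, in which case \<open>m\<close> is only an
  upper bound. This lets summands that do not reach \<open>m\<close> be added to one that
  does.\<close>

definition leads_with :: "cpoly \<Rightarrow> (nat \<Rightarrow>\<^sub>0 nat) \<Rightarrow> complex \<Rightarrow> bool" where
  "leads_with f m c \<longleftrightarrow> keys f \<subseteq> {..m} \<and> lookup f m = c"

lemma leads_with_Max:
  assumes "leads_with f m c" "c \<noteq> 0"
  shows "f \<noteq> 0" "Max (keys f) = m"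
  using assms by (auto simp: leads_with_def in_keys_iff intro!: Max_eqI)

lemma leads_with_single: "leads_with (single m c) m c"
  by (simp add: leads_with_def)

lemma leads_with_weaken:
  assumes "leads_with f m c" "m < m'"
  shows "leads_with f m' 0"
  using assms by (force simp: leads_with_def in_keys_iff)

lemma leads_with_sum:
  assumes "\<And>a. a \<in> A \<Longrightarrow> leads_with (f a) m (c a)"
  shows "leads_with (sum f A) m (sum c A)"
  using assms Poly_Mapping.keys_sum[of f A] unfolding leads_with_def
  by (fastforce simp: lookup_sum)

text \<open>Addition of exponent vectors is strictly monotone, so among pairs of monomials bounded
  by \<open>m\<close> and \<open>m'\<close> only the pair \<open>m\<close>, \<open>m'\<close> itself
  has sum \<open>m + m'\<close>.\<close>

lemma leads_with_mult:
  assumes "leads_with f m c" "leads_with g m' c'"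
  shows "leads_with (f * g) (m + m') (c * c')"
proof -
  have f: "a \<le> m" if "a \<in> insert m (keys f)" for a using that assms by (auto simp: leads_with_def)
  have g: "b \<le> m'" if "b \<in> insert m' (keys g)" for b using that assms by (auto simp: leads_with_def)
  \<comment> \<open>The bounding monomial is inserted because it need not occur in
    \<open>h\<close>.\<close>
  have expand: "h = (\<Sum>a\<in>insert k (keys h). single a (lookup h a))" for h :: cpoly and k
    by (subst (1) sum_monomials[of h, symmetric], rule sum.mono_neutral_left) (auto simp: in_keys_iff)
  have eq: "a + b = m + m' \<longleftrightarrow> a = m \<and> b = m'"
    if "a \<in> insert m (keys f)" "b \<in> insert m' (keys g)" for a b
    using f[OF that(1)] g[OF that(2)] add_less_le_mono[of a m b m'] add_le_less_mono[of a m b m']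
    by (metis less_irrefl order_le_imp_less_or_eq)
  have "f * g = (\<Sum>a\<in>insert m (keys f). \<Sum>b\<in>insert m' (keys g). single (a + b) (lookup f a * lookup g b))"
    by (subst (1) expand[of f m], subst (1) expand[of g m']) (simp only: sum_product mult_single)
  then have "lookup (f * g) (m + m') = (\<Sum>a\<in>insert m (keys f). \<Sum>b\<in>insert m' (keys g).
      if a + b = m + m' then lookup f a * lookup g b else 0)"
    by (simp only: lookup_sum lookup_single when_def)
  also have "\<dots> = (\<Sum>a\<in>insert m (keys f). \<Sum>b\<in>insert m' (keys g).
      if b = m' then (if a = m then lookup f a * lookup g b else 0) else 0)"
    by (intro sum.cong refl) (auto simp only: eq split: if_splits)
  also have "\<dots> = c * c'"
    using assms by (simp only: sum.delta finite_insert finite_keys insertI1 if_True leads_with_def)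
  finally have "lookup (f * g) (m + m') = c * c'" .
  moreover have "keys (f * g) \<subseteq> {..m + m'}"
  proof
    fix x assume "x \<in> keys (f * g)"
    then obtain a b where "x = a + b" "a \<in> keys f" "b \<in> keys g" using keys_mult[of f g] by blast
    then show "x \<in> {..m + m'}" using f g by (auto intro: add_mono)
  qed
  ultimately show ?thesis by (simp add: leads_with_def)
qed

lemma leads_with_prod:
  assumes "finite A" "\<And>a. a \<in> A \<Longrightarrow> leads_with (f a) (m a) (c a)"
  shows "leads_with (prod f A) (sum m A) (prod c A)"
  using assms
proof (induction A rule: finite_induct)
  case empty
  then show ?case using leads_with_single[of 0 1] by simp
next
  case (insert a A)
  then show ?case by (simp add: leads_with_mult)
qed

lemma single_index_less_iff:
  fixes i j :: nat
  shows "single i (1::nat) < single j 1 \<longleftrightarrow> j < i"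
proof
  assume "j < i"
  then show "single i (1::nat) < single j 1"
    unfolding lex_order_iff by (intro exI[of _ j]) (auto simp: lookup_single when_def)
next
  assume "single i (1::nat) < single j 1"
  then show "j < i"
    unfolding lex_order_iff by (fastforce simp: lookup_single when_def split: if_splits)
qed

text \<open>A smaller index means a larger unknown, so the first coefficient not known to vanish
  leads.\<close>

lemma leads_with_shifted_form:
  assumes "\<And>l. l < p \<Longrightarrow> a l = 0" "p \<le> r"
  shows "leads_with (shifted_form a r j) (single (p + j) 1) (a p)"
proof -
  have "x \<le> single (p + j) 1" if x: "x \<in> keys (shifted_form a r j)" for x
  proof -
    obtain l where l: "x = single (l + j) 1" "a l \<noteq> 0" using x keys_shifted_form[of a r j] by auto
    then have "p \<le> l" using assms(1)[of l] by (metis not_le)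
    then show ?thesis
      unfolding l(1) using single_index_less_iff[of "l + j" "p + j"] by (cases "p = l") auto
  qed
  moreover have "lookup (shifted_form a r j) (single (p + j) 1) = a p"
    unfolding lookup_shifted_form using assms by simp
  ultimately show ?thesis by (auto simp: leads_with_def)
qed

text \<open>At the first index \<open>k\<close> moved by \<open>q\<close>, only the identity contributes \<open>t\<^bsub>k + s k\<^esub>\<close>; all
  other factors with index \<open>i \<ge> k\<close> are smaller variables.\<close>

lemma diagonal_monomial_greatest:
  fixes s :: "nat \<Rightarrow> nat"
  assumes q: "q permutes {0..<n}" "q \<noteq> id" and s: "\<And>i j. i < j \<Longrightarrow> j < n \<Longrightarrow> s i < s j"
  shows "(\<Sum>i=0..<n. single (i + s (q i)) (1::nat)) < (\<Sum>i=0..<n. single (i + s i) 1)"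
proof -
  define k where "k = (LEAST k. q k \<noteq> k)"
  have "\<exists>k. q k \<noteq> k" using q(2) by (auto simp: fun_eq_iff)
  then have k: "q k \<noteq> k" unfolding k_def by (metis (mono_tags, lifting) LeastI)
  have below: "q i = i" if "i < k" for i using that not_less_Least unfolding k_def by blast
  have kn: "k < n" using k q(1) by (metis atLeastLessThan_iff permutes_not_in zero_le)
  have inj: "inj q" using q(1) by (rule permutes_inj)
  have above: "k \<le> q i" if "k \<le> i" for i
  proof (rule ccontr)
    assume "\<not> k \<le> q i"
    then have "q (q i) = q i" using below by simp
    then have "q i = i" using inj by (simp add: inj_eq)
    then show False using that \<open>\<not> k \<le> q i\<close> by simp
  qed
  have qn: "q i < n" if "i < n" for i
    using q(1) that permutes_in_image[of q "{0..<n}" i] by simp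
  have s_mono: "s i \<le> s j" if "i \<le> j" "j < n" for i j
    using s[of i j] that by (cases "i = j") auto
  have lookup_eq: "lookup (\<Sum>i=0..<n. single (i + s (p i)) (1::nat)) x
      = (\<Sum>i=0..<k. if i + s (p i) = x then 1 else 0) + (\<Sum>i=k..<n. if i + s (p i) = x then 1 else 0)" for p x
    using sum.atLeastLessThan_concat[of 0 k n "\<lambda>i. if i + s (p i) = x then 1::nat else 0"] kn
    unfolding lookup_sum lookup_single when_def by simp
  \<comment> \<open>For \<open>i = k\<close> the strict gain comes from \<open>s (q k)\<close>, for
    \<open>i > k\<close> from \<open>i\<close> itself. So no factor from row \<open>k\<close> on has
    an index as small as \<open>k + s k\<close>.\<close>
  have large: "i + s (q i) > k + s k" if "i \<in> {k..<n}" for i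
  proof (cases "i = k")
    case True
    then show ?thesis using above[of k] k s[of k "q k"] qn[OF kn] by simp
  next
    case False
    then show ?thesis using above[of i] s_mono[of k "q i"] qn[of i] that by simp
  qed
  have large': "i + s i > k + s k" if "i \<in> {k<..<n}" for i
    using that s[of k i] by simp
  have q0: "(\<Sum>i=k..<n. if i + s (q i) = x then 1 else 0) = (0::nat)" if "x \<le> k + s k" for x
    using large that by (intro sum.neutral) fastforce
  have id0: "(\<Sum>i=k..<n. if i + s i = x then 1 else 0) = (if x = k + s k then 1 else 0 :: nat)" if "x \<le> k + s k" for x
  proof -
    have "{k..<n} = insert k {k<..<n}" using kn by auto
    moreover have "(\<Sum>i\<in>{k<..<n}. if i + s i = x then 1 else 0) = (0::nat)"
      using large' that by (intro sum.neutral) fastforce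
    ultimately show ?thesis by simp
  qed
  have pre: "(\<Sum>i=0..<k. if i + s (q i) = x then 1 else 0) = (\<Sum>i=0..<k. if i + s i = x then 1 else (0::nat))" for x
    by (intro sum.cong) (auto simp: below)
  show ?thesis
    unfolding lex_order_iff
  proof (intro exI[of _ "k + s k"] conjI allI impI)
    show "lookup (\<Sum>i=0..<n. single (i + s (q i)) (1::nat)) (k + s k) < lookup (\<Sum>i=0..<n. single (i + s i) 1) (k + s k)"
      unfolding lookup_eq[of q] lookup_eq[of "\<lambda>i. i"] pre q0[OF order_refl] id0[OF order_refl] by simp
    fix x assume "x < k + s k"
    then show "lookup (\<Sum>i=0..<n. single (i + s (q i)) (1::nat)) x = lookup (\<Sum>i=0..<n. single (i + s i) 1) x"
      unfolding lookup_eq[of q] lookup_eq[of "\<lambda>i. i"] pre by (simp add: q0 id0)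
  qed
qed

text \<open>In the Leibniz expansion, the term of \<open>p\<close> is led by the product of the
  unknowns with indices \<open>\<pi> i + s (p i)\<close>. Reindexing the rows along
  \<open>\<pi>\<close> turns this into the situation of \<open>diagonal_monomial_greatest\<close>,
  where only \<open>p = \<pi>\<close> gives the diagonal.\<close>

lemma leads_with_det_shifted_forms:
  assumes A: "A \<in> carrier_mat n n"
    and entries: "\<And>i k. i < n \<Longrightarrow> k < n \<Longrightarrow> A $$ (i, k) = shifted_form (a i) r (s k)"
    and \<pi>: "\<pi> permutes {0..<n}" and le: "\<And>i. i < n \<Longrightarrow> \<pi> i \<le> r"
    and zero: "\<And>i l. i < n \<Longrightarrow> l < \<pi> i \<Longrightarrow> a i l = 0"
    and s: "\<And>i j. i < j \<Longrightarrow> j < n \<Longrightarrow> s i < s j"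
  shows "leads_with (det A) (\<Sum>i=0..<n. single (i + s i) 1) (signof \<pi> * (\<Prod>i=0..<n. a i (\<pi> i)))"
proof -
  let ?m = "\<Sum>i=0..<n. single (i + s i) (1::nat)"
  have summand: "leads_with (signof p * (\<Prod>i=0..<n. A $$ (i, p i))) ?m
      (if p = \<pi> then signof \<pi> * (\<Prod>i=0..<n. a i (\<pi> i)) else 0)"
    if p: "p permutes {0..<n}" for p
  proof -
    have "leads_with (A $$ (i, p i)) (single (\<pi> i + s (p i)) 1) (a i (\<pi> i))" if "i \<in> {0..<n}" for i
    proof -
      have "p i < n" using p that permutes_in_image[of p "{0..<n}" i] by simp
      then show ?thesis
        using that by (simp only: entries atLeastLessThan_iff) (rule leads_with_shifted_form; simp add: zero le)
    qed
    then have "leads_with (\<Prod>i=0..<n. A $$ (i, p i)) (\<Sum>i=0..<n. single (\<pi> i + s (p i)) 1) (\<Prod>i=0..<n. a i (\<pi> i))"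
      by (intro leads_with_prod) auto
    moreover have "leads_with (signof p) 0 (signof p)"
      unfolding signof_single by (rule leads_with_single)
    ultimately have *: "leads_with (signof p * (\<Prod>i=0..<n. A $$ (i, p i)))
        (\<Sum>i=0..<n. single (\<pi> i + s (p i)) 1) (signof p * (\<Prod>i=0..<n. a i (\<pi> i)))"
      using leads_with_mult by fastforce
    define q where "q = p \<circ> inv_into UNIV \<pi>"
    have q: "q permutes {0..<n}" unfolding q_def
      by (rule permutes_compose[OF permutes_inv[OF \<pi>] p])
    have p_eq: "p i = q (\<pi> i)" for i
      unfolding q_def using permutes_inverses(2)[OF \<pi>] by simp
    have m: "(\<Sum>i=0..<n. single (\<pi> i + s (p i)) (1::nat)) = (\<Sum>i=0..<n. single (i + s (q i)) 1)"
      unfolding p_eq using sum.permute[OF \<pi>, of "\<lambda>i. single (i + s (q i)) (1::nat)"] by (simp add: o_def)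
    show ?thesis
    proof (cases "p = \<pi>")
      case True
      then have "q = id" unfolding q_def using permutes_inv_o(1)[OF \<pi>] by simp
      then show ?thesis using * True unfolding m by simp
    next
      case False
      then have "q \<noteq> id" using p_eq by (auto simp: fun_eq_iff)
      then show ?thesis
        using leads_with_weaken[OF *, unfolded m] diagonal_monomial_greatest[OF q \<open>q \<noteq> id\<close>, of s] s False by simp
    qed
  qed
  have "leads_with (det A) ?m
      (\<Sum>p | p permutes {0..<n}. if p = \<pi> then signof \<pi> * (\<Prod>i=0..<n. a i (\<pi> i)) else 0)"
    unfolding det_def'[OF A] by (intro leads_with_sum summand) simp
  then show ?thesis using \<pi> by (simp add: finite_permutations)
qed

section \<open>The coefficients of the matrices\<close>

definition row_coeff :: "nat \<Rightarrow> nat \<Rightarrow> nat \<Rightarrow> complex" where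
  "row_coeff r i l = lookup (first_column r ! i) (single l 1)"

lemma shifted_form_add: "shifted_form (\<lambda>l. a l + b l) r j = shifted_form a r j + shifted_form b r j"
  by (simp add: shifted_form_def single_add sum.distrib)

lemma shifted_form_diff: "shifted_form (\<lambda>l. a l - b l) r j = shifted_form a r j - shifted_form b r j"
  by (simp add: shifted_form_def single_diff sum_subtractf)

lemma numeral_mult_single: "(numeral w :: cpoly) * single m c = single m (numeral w * c)"
  by (simp only: single_numeral[symmetric] mult_single add_0)

lemma shifted_form_numeral: "shifted_form (\<lambda>l. numeral w * a l) r j = numeral w * shifted_form a r j"
  by (simp add: shifted_form_def sum_distrib_left numeral_mult_single)

lemma lookup_tvar: "lookup (tvar i) (single l 1) = (if i = l then 1 else 0)"
  unfolding tvar_def lookup_single single_index_eq_iff when_def ..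

lemma lookup_numeral_mult: "lookup (numeral w * f :: cpoly) m = numeral w * lookup f m"
proof -
  have "numeral w * f = (\<Sum>k\<in>keys f. single k (numeral w * lookup f k))"
    by (subst (1) sum_monomials[of f, symmetric]) (simp add: sum_distrib_left numeral_mult_single)
  then have "lookup (numeral w * f) m = (\<Sum>k\<in>keys f. if k = m then numeral w * lookup f k else 0)"
    by (simp only: lookup_sum lookup_single when_def)
  then show ?thesis by (auto simp: in_keys_iff)
qed

lemmas lookup_linear = lookup_tvar lookup_numeral_mult lookup_add lookup_minus

text \<open>A linear form in the first \<open>r + 1\<close> unknowns, encoded by rebuilding
  \<open>f\<close> from its own coefficients. The condition is stable under the operations that
  build \<open>first_column\<close>, so it can be checked entry by entry.\<close>

definition linear_upto :: "nat \<Rightarrow> cpoly \<Rightarrow> bool" where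
  "linear_upto r f \<longleftrightarrow> f = shifted_form (\<lambda>l. lookup f (single l 1)) r 0"

lemma linear_upto_tvar: "i \<le> r \<Longrightarrow> linear_upto r (tvar i)"
proof -
  assume "i \<le> r"
  moreover have "(\<Sum>l\<le>r. single (single l 1) (if i = l then 1 else 0))
      = (\<Sum>l\<le>r. if l = i then single (single l (1::nat)) (1::complex) else 0)"
    by (intro sum.cong) auto
  ultimately show ?thesis
    unfolding linear_upto_def shifted_form_def lookup_tvar by (simp add: tvar_def)
qed

lemma linear_upto_add: "linear_upto r f \<Longrightarrow> linear_upto r g \<Longrightarrow> linear_upto r (f + g)"
  unfolding linear_upto_def lookup_add shifted_form_add by simp

lemma linear_upto_diff: "linear_upto r f \<Longrightarrow> linear_upto r g \<Longrightarrow> linear_upto r (f - g)"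
  unfolding linear_upto_def lookup_minus shifted_form_diff by simp

lemma linear_upto_numeral: "linear_upto r f \<Longrightarrow> linear_upto r (numeral w * f)"
  unfolding linear_upto_def lookup_numeral_mult shifted_form_numeral by simp

text \<open>This is \<open>2 z q' - r q\<close> evaluated at \<open>z\<close>, for \<open>q = \<Sum>\<^sub>l a l X\<^sup>l\<close>.\<close>

definition tight_functional :: "nat \<Rightarrow> complex \<Rightarrow> (nat \<Rightarrow> complex) \<Rightarrow> complex" where
  "tight_functional r z a = (\<Sum>l\<le>r. (2 * of_nat l - of_nat r) * z ^ l * a l)"

lemma tight_functional_tvar:
  "i \<le> r \<Longrightarrow> tight_functional r z (\<lambda>l. lookup (tvar i) (single l 1)) = (2 * of_nat i - of_nat r) * z ^ i"
  unfolding tight_functional_def lookup_tvar by (simp add: if_distrib[of "\<lambda>x. _ * x"] cong: if_cong)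

lemma tight_functional_add:
  "tight_functional r z (\<lambda>l. a l + b l) = tight_functional r z a + tight_functional r z b"
  unfolding tight_functional_def by (simp add: sum.distrib distrib_left)

lemma tight_functional_diff:
  "tight_functional r z (\<lambda>l. a l - b l) = tight_functional r z a - tight_functional r z b"
  unfolding tight_functional_def by (simp add: sum_subtractf right_diff_distrib)

lemma tight_functional_scale:
  "tight_functional r z (\<lambda>l. c * a l) = c * tight_functional r z a"
  unfolding tight_functional_def by (simp add: sum_distrib_left mult_ac)

lemma tight_functional_sum:
  "tight_functional r z (\<lambda>l. \<Sum>i\<in>A. a i l) = (\<Sum>i\<in>A. tight_functional r z (a i))"
  unfolding tight_functional_def sum_distrib_left by (rule sum.swap)

section \<open>Finite checks on the first columns\<close>

lemma first_column_cases:
  assumes "r \<in> {3..9::nat}"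
  obtains "r = 3" | "r = 4" | "r = 5" | "r = 6" | "r = 7" | "r = 8" | "r = 9"
  using assms by (auto simp: eval_nat_numeral le_Suc_eq)

lemma length_first_column: "r \<in> {3..9} \<Longrightarrow> length (first_column r) = r - 1"
  by (erule first_column_cases) (simp_all add: first_column_def)

lemma first_column_linear:
  assumes "r \<in> {3..9}"
  shows "\<forall>f\<in>set (first_column r). linear_upto r f"
  using assms
  by (rule first_column_cases)
    (simp_all add: first_column_def linear_upto_tvar linear_upto_add linear_upto_diff linear_upto_numeral)

text \<open>The powers of \<open>z\<close> have period 4, which leaves a numerical identity for each
  entry. The middle index \<open>l = r / 2\<close> has weight 0, which is why a single unknown can
  form an entry when \<open>r\<close> is even.\<close>

lemma first_column_tight:
  assumes "r \<in> {3..9}" "z\<^sup>2 = -1"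
  shows "\<forall>f\<in>set (first_column r). tight_functional r z (\<lambda>l. lookup f (single l 1)) = 0"
proof -
  have z: "z ^ 3 = - z" "z ^ 4 = 1" "z ^ 5 = z" "z ^ 6 = -1" "z ^ 7 = - z" "z ^ 8 = 1" "z ^ 9 = z"
    using assms(2) by (auto simp: eval_nat_numeral)
  show ?thesis
    using assms(1)
    by (rule first_column_cases)
      (simp_all add: first_column_def lookup_numeral_mult lookup_add lookup_minus tight_functional_add
        tight_functional_diff tight_functional_scale tight_functional_tvar[simplified] z assms(2))
qed

text \<open>Only in \<open>M\<^sub>8\<close> are the leading unknowns of the rows not in increasing order.\<close>

definition pivot :: "nat \<Rightarrow> nat \<Rightarrow> nat" where
  "pivot r = (if r = 8 then transpose 2 4 else id)"

lemma pivot_permutes: "r \<in> {3..9} \<Longrightarrow> pivot r permutes {0..<r - 1}"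
  by (auto simp: pivot_def permutes_id intro!: permutes_swap_id)

lemma row_coeff_pivot:
  assumes "r \<in> {3..9}" "i < r - 1"
  shows "row_coeff r i (pivot r i) \<noteq> 0" "l < pivot r i \<Longrightarrow> row_coeff r i l = 0"
proof -
  have *: "i = 0 \<or> i = 1 \<or> i = 2 \<or> i = 3 \<or> i = 4 \<or> i = 5 \<or> i = 6 \<or> i = 7" using assms by auto
  show "row_coeff r i (pivot r i) \<noteq> 0"
    using assms(1) apply (rule first_column_cases)
    using * assms(2) apply safe
    apply (simp_all add: row_coeff_def first_column_def pivot_def lookup_linear[simplified] transpose_def)
    done
  show "row_coeff r i l = 0" if "l < pivot r i"
    using assms(1) apply (rule first_column_cases)
    using * assms(2) that apply safe
    apply (simp_all add: row_coeff_def first_column_def pivot_def lookup_linear[simplified] transpose_def)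
    done
qed

text \<open>The pivots reach only the indices below \<open>r - 1\<close>. The two remaining unknowns
  must be located separately in order to count \<open>r + 1\<close> unknowns per column.\<close>

lemma row_coeff_last:
  assumes "r \<in> {3..9}"
  shows "\<exists>i<r - 1. row_coeff r i (r - 1) \<noteq> 0" "\<exists>i<r - 1. row_coeff r i r \<noteq> 0"
proof -
  show "\<exists>i<r - 1. row_coeff r i (r - 1) \<noteq> 0"
    using assms
    by (rule first_column_cases)
      (rule exI[of _ "if r = 4 then 1 else if r = 6 then 1 else r - 3"], simp add: row_coeff_def first_column_def lookup_linear[simplified])+
  show "\<exists>i<r - 1. row_coeff r i r \<noteq> 0"
    using assms
    by (rule first_column_cases)
      (rule exI[of _ "if r = 4 then 0 else r - 2"], simp add: row_coeff_def first_column_def lookup_linear[simplified])+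
qed

section \<open>Vanishing of the minors\<close>

lemma linear_factor_mult_degree:
  fixes p :: "'a::comm_ring_1 poly"
  shows "degree p \<le> n \<Longrightarrow> degree ([:a, b:] * p) \<le> Suc n"
  by (rule degree_le) (auto simp: coeff_eq_0 coeff_pCons split: nat.splits)

lemma degree_prod_linear:
  fixes x y :: "nat \<Rightarrow> 'a::comm_ring_1"
  assumes "finite S"
  shows "degree (\<Prod>j\<in>S. [:- x j, y j:]) \<le> card S"
  using assms
proof (induction S rule: finite_induct)
  case (insert s S)
  then show ?case
    using linear_factor_mult_degree[of "\<Prod>j\<in>S. [:- x j, y j:]" "card S" "- x s" "y s"] by simp
qed simp

text \<open>The homogenization uses the formal degree \<open>card S\<close>, since factors with
  \<open>y j = 0\<close> lower the actual degree. Multiplying by one more factor contributes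
  \<open>- x s * Y\<close> from its constant part and \<open>y s * X\<close> from its shift.\<close>

lemma homogenized_prod_linear:
  fixes x y :: "nat \<Rightarrow> 'a::comm_ring_1"
  assumes "finite S"
  shows "(\<Sum>l\<le>card S. coeff (\<Prod>j\<in>S. [:- x j, y j:]) l * X ^ l * Y ^ (card S - l))
    = (\<Prod>j\<in>S. y j * X - x j * Y)"
  using assms
proof (induction S rule: finite_induct)
  case (insert s S)
  let ?p = "\<Prod>j\<in>S. [:- x j, y j:]" and ?n = "card S"
  have c0: "coeff ?p (Suc ?n) = 0"
    using degree_prod_linear[OF insert(1), of x y] by (intro coeff_eq_0) simp
  have "(\<Sum>l\<le>Suc ?n. coeff ([:- x s, y s:] * ?p) l * X ^ l * Y ^ (Suc ?n - l))
      = - x s * (\<Sum>l\<le>Suc ?n. coeff ?p l * X ^ l * Y ^ (Suc ?n - l))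
      + y s * (\<Sum>l\<le>Suc ?n. coeff (pCons 0 ?p) l * X ^ l * Y ^ (Suc ?n - l))"
    by (simp only: sum_distrib_left flip: sum.distrib)
      (rule sum.cong, auto simp: coeff_pCons algebra_simps split: nat.splits)
  also have "(\<Sum>l\<le>Suc ?n. coeff ?p l * X ^ l * Y ^ (Suc ?n - l))
      = Y * (\<Sum>l\<le>?n. coeff ?p l * X ^ l * Y ^ (?n - l))"
    by (simp add: c0 sum_distrib_left Suc_diff_le mult_ac)
  also have "(\<Sum>l\<le>Suc ?n. coeff (pCons 0 ?p) l * X ^ l * Y ^ (Suc ?n - l))
      = X * (\<Sum>l\<le>?n. coeff ?p l * X ^ l * Y ^ (?n - l))"
    by (simp only: sum.atMost_Suc_shift) (simp add: sum_distrib_left mult_ac)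
  finally show ?case using insert by (simp add: algebra_simps)
qed simp

lemma tight_functional_coeff:
  assumes "degree q \<le> r"
  shows "tight_functional r z (coeff q) = 2 * z * poly (pderiv q) z - of_nat r * poly q z"
proof -
  have "poly q z = (\<Sum>l\<le>r. coeff q l * z ^ l)"
    unfolding poly_altdef using assms
    by (intro sum.mono_neutral_left) (auto simp: coeff_eq_0)
  moreover have "z * poly (pderiv q) z = (\<Sum>l\<le>r. of_nat l * coeff q l * z ^ l)"
  proof -
    have "poly (pderiv q) z = (\<Sum>l\<le>r. coeff (pderiv q) l * z ^ l)"
      unfolding poly_altdef using assms
      by (intro sum.mono_neutral_left) (auto simp: coeff_eq_0 degree_pderiv)
    also have "z * \<dots> = (\<Sum>l\<le>r. of_nat (Suc l) * coeff q (Suc l) * z ^ Suc l)"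
      by (simp add: sum_distrib_left coeff_pderiv mult_ac)
    also have "\<dots> = (\<Sum>l\<le>Suc r. of_nat l * coeff q l * z ^ l)"
      by (simp only: sum.atMost_Suc_shift) simp
    finally show ?thesis using assms by (simp add: coeff_eq_0)
  qed
  ultimately show ?thesis
    unfolding tight_functional_def
    by (simp add: sum_distrib_left mult.assoc flip: sum_subtractf)
      (rule sum.cong, auto simp: algebra_simps)
qed

text \<open>Since \<open>z\<^sup>2 = -1\<close>, the unit condition reads
  \<open>(y j * z - x j) * (x j + z * y j) = -1\<close>. The product rule writes the functional as a
  sum over \<open>j\<close> of \<open>x j + z * y j\<close> times the product of the other factors.
  By that identity, each summand is \<open>- q(z)\<close> times the square of
  \<open>x j + z * y j\<close>, and these squares add up to 0.\<close>

lemma tight_functional_prod_linear: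
  assumes z: "z\<^sup>2 = -1" and unit: "\<And>j. j < r \<Longrightarrow> (x j)\<^sup>2 + (y j)\<^sup>2 = 1"
    and isotropic: "(\<Sum>j<r. (x j + z * y j)\<^sup>2) = 0"
  shows "tight_functional r z (coeff (\<Prod>j<r. [:- x j, y j:])) = 0"
proof -
  let ?q = "\<Prod>j<r. [:- x j, y j:]"
  have nz: "y j * z - x j \<noteq> 0" "x j + z * y j = - (y j * z - x j) * (x j + z * y j)\<^sup>2" if "j < r" for j
  proof -
    have *: "(y j * z - x j) * (x j + z * y j) = -1"
    proof -
      have "(y j * z - x j) * (x j + z * y j) = z\<^sup>2 * (y j)\<^sup>2 - (x j)\<^sup>2"
        by (simp add: power2_eq_square algebra_simps)
      also have "\<dots> = - ((x j)\<^sup>2 + (y j)\<^sup>2)" unfolding z by simp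
      finally show ?thesis unfolding unit[OF that] .
    qed
    then show "y j * z - x j \<noteq> 0" by auto
    show "x j + z * y j = - (y j * z - x j) * (x j + z * y j)\<^sup>2"
    proof -
      have "- (y j * z - x j) * (x j + z * y j)\<^sup>2 = - ((y j * z - x j) * (x j + z * y j)) * (x j + z * y j)"
        by (simp add: power2_eq_square algebra_simps)
      then show ?thesis unfolding * by simp
    qed
  qed
  have P: "poly ?q z = (y j * z - x j) * (\<Prod>k\<in>{..<r} - {j}. y k * z - x k)" if "j < r" for j
    using that by (simp add: poly_prod prod.remove[of "{..<r}" j] algebra_simps)
  have "2 * z * poly (pderiv ?q) z - of_nat r * poly ?q z
      = (\<Sum>j<r. 2 * z * ((\<Prod>k\<in>{..<r} - {j}. y k * z - x k) * y j) - poly ?q z)"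
    by (simp add: pderiv_prod poly_sum poly_prod pderiv_pCons sum_distrib_left sum_subtractf algebra_simps)
  also have "\<dots> = (\<Sum>j<r. - poly ?q z * (x j + z * y j)\<^sup>2)"
  proof (intro sum.cong refl)
    fix j assume "j \<in> {..<r}"
    then have j: "j < r" by simp
    let ?R = "\<Prod>k\<in>{..<r} - {j}. y k * z - x k"
    have "2 * z * (?R * y j) - poly ?q z = ?R * (x j + z * y j)"
      unfolding P[OF j] by (simp add: algebra_simps)
    also have "\<dots> = ?R * (- (y j * z - x j) * (x j + z * y j)\<^sup>2)"
      using nz(2)[OF j] by simp
    also have "\<dots> = - poly ?q z * (x j + z * y j)\<^sup>2"
      unfolding P[OF j] by (simp add: algebra_simps)
    finally show "2 * z * (?R * y j) - poly ?q z = - poly ?q z * (x j + z * y j)\<^sup>2" .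
  qed
  also have "\<dots> = 0"
    using isotropic by (simp only: mult_zero_right flip: sum_distrib_left)
  finally show ?thesis
    using tight_functional_coeff[of ?q r z] degree_prod_linear[of "{..<r}" x y] by simp
qed

text \<open>Triangular elimination: the row with pivot \<open>n\<close> vanishes before
  \<open>n\<close>, so a multiple of it corrects index \<open>n\<close> without disturbing the
  smaller ones.\<close>

lemma row_combination_prefix:
  assumes "r \<in> {3..9}" "n \<le> r - 1"
  shows "\<exists>c. \<forall>l<n. (\<Sum>i<r - 1. c i * row_coeff r i l) = q l"
  using assms(2)
proof (induction n)
  case (Suc n)
  then obtain c where c: "\<And>l. l < n \<Longrightarrow> (\<Sum>i<r - 1. c i * row_coeff r i l) = q l" by auto
  have "n \<in> pivot r ` {0..<r - 1}"
    using permutes_image[OF pivot_permutes[OF assms(1)]] Suc.prems by simp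
  then obtain k where k: "k < r - 1" "pivot r k = n" by auto
  define e where "e = (q n - (\<Sum>i<r - 1. c i * row_coeff r i n)) / row_coeff r k n"
  have nz: "row_coeff r k n \<noteq> 0" using row_coeff_pivot(1)[OF assms(1) k(1)] k(2) by simp
  have *: "(\<Sum>i<r - 1. (c i + (if i = k then e else 0)) * row_coeff r i l)
      = (\<Sum>i<r - 1. c i * row_coeff r i l) + e * row_coeff r k l" for l
  proof -
    have "(\<Sum>i<r - 1. (c i + (if i = k then e else 0)) * row_coeff r i l)
      = (\<Sum>i<r - 1. c i * row_coeff r i l + (if i = k then e * row_coeff r i l else 0))"
      by (intro sum.cong) (auto simp: algebra_simps)
    then show ?thesis using k(1) by (simp add: sum.distrib)
  qed
  have "(\<Sum>i<r - 1. (c i + (if i = k then e else 0)) * row_coeff r i l) = q l" if "l < Suc n" for l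
  proof (cases "l = n")
    case True
    then show ?thesis unfolding * using nz by (simp add: e_def)
  next
    case False
    then have "l < n" using that by simp
    then have "row_coeff r k l = 0" using row_coeff_pivot(2)[OF assms(1) k(1)] k(2) by simp
    then show ?thesis unfolding * using c[OF \<open>l < n\<close>] by simp
  qed
  then show ?case by (intro exI[of _ "\<lambda>i. c i + (if i = k then e else 0)"] allI impI)
qed simp

text \<open>Modulo the rows, a coefficient vector is supported on the last two indices, which have
  different parity; the two functionals for \<open>z = \<plusminus>\<i>\<close> then force it to vanish.\<close>

lemma row_combination:
  assumes r: "r \<in> {3..9}" and q: "tight_functional r \<i> q = 0" "tight_functional r (- \<i>) q = 0"
  obtains c where "\<And>l. l \<le> r \<Longrightarrow> q l = (\<Sum>i<r - 1. c i * row_coeff r i l)"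
proof -
  obtain c where c: "\<And>l. l < r - 1 \<Longrightarrow> (\<Sum>i<r - 1. c i * row_coeff r i l) = q l"
    using row_combination_prefix[OF r order_refl, of q] by blast
  define u where "u l = q l - (\<Sum>i<r - 1. c i * row_coeff r i l)" for l
  \<comment> \<open>With \<open>r = k + 3\<close>, the two indices left over are
    \<open>k + 2 = r - 1\<close> and \<open>r\<close>. Their weights \<open>2 * l - r\<close> are
    \<open>k + 1\<close> and \<open>k + 3\<close>, both nonzero.\<close>
  obtain k where k: "r = Suc (Suc (Suc k))"
    using r le_Suc_ex[of 3 r] by (auto simp: numeral_3_eq_3)
  have u0: "u l = 0" if "l < Suc (Suc k)" for l using c that k by (simp add: u_def)
  have row: "tight_functional r z (row_coeff r i) = 0" if "z\<^sup>2 = -1" "i < r - 1" for z i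
    using first_column_tight[OF r that(1)] length_first_column[OF r] that(2)
    unfolding row_coeff_def by (metis nth_mem)
  have u: "tight_functional r z u = 0" if "z\<^sup>2 = -1" "tight_functional r z q = 0" for z
    unfolding u_def using that row[OF that(1)]
    by (simp add: tight_functional_diff tight_functional_sum tight_functional_scale)
  have "(\<Sum>l\<le>Suc k. (2 * of_nat l - of_nat r) * z ^ l * u l) = 0" for z
    by (intro sum.neutral) (simp add: u0)
  then have two_terms: "tight_functional r z u = z ^ Suc (Suc k) * ((of_nat k + 1) * u (Suc (Suc k))
      + (of_nat k + 3) * z * u r)" for z
    unfolding tight_functional_def by (simp add: k algebra_simps)
  have *: "(of_nat k + 1) * u (Suc (Suc k)) + (of_nat k + 3) * z * u r = 0"
    if "z\<^sup>2 = -1" "tight_functional r z q = 0" for z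
  proof -
    have "z \<noteq> 0" using that(1) by auto
    then show ?thesis using u[OF that] two_terms[of z] by simp
  qed
  have "of_nat k + 1 = (of_nat (Suc k) :: complex)" "of_nat k + 3 = (of_nat (Suc (k + 2)) :: complex)"
    by simp_all
  then have p: "of_nat k + 1 \<noteq> (0::complex)" "of_nat k + 3 \<noteq> (0::complex)"
    by (simp_all only: of_nat_neq_0 not_False_eq_True)
  \<comment> \<open>The extra factor \<open>z\<close> separates the two terms: the functionals at
    \<open>\<i>\<close> and \<open>- \<i>\<close> give \<open>A + B\<close> and
    \<open>A - B\<close>.\<close>
  define A B where "A = (of_nat k + 1) * u (Suc (Suc k))" and "B = (of_nat k + 3) * \<i> * u r"
  have "A + B = 0" using *[of \<i>] q unfolding A_def B_def by simp
  moreover have "A - B = 0" using *[of "- \<i>"] q unfolding A_def B_def by simp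
  ultimately have "A = B" "2 * B = 0" by simp_all
  then have "A = 0" "B = 0" by simp_all
  then have "(of_nat k + 1) * u (Suc (Suc k)) = 0" "(of_nat k + 3) * \<i> * u r = 0"
    unfolding A_def B_def .
  then have "u (Suc (Suc k)) = 0" "u r = 0" using p by auto
  then have "u l = 0" if "l \<le> r" for l
    using u0[of l] that k by (cases "l < Suc (Suc k)") (auto simp: le_Suc_eq)
  then show thesis by (intro that[of c]) (simp add: u_def)
qed

section \<open>A common left kernel vector of the minors\<close>

lemma fradeco_matrix_entry:
  assumes "r \<in> {3..9}" "i < r - 1" "j < d - r + 1"
  shows "fradeco_matrix r d $$ (i, j) = shifted_form (row_coeff r i) r j"
proof -
  have "first_column r ! i \<in> set (first_column r)"
    using length_first_column[OF assms(1)] assms(2) by simp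
  then have "linear_upto r (first_column r ! i)" using first_column_linear[OF assms(1)] by blast
  then have "first_column r ! i = shifted_form (row_coeff r i) r 0"
    unfolding linear_upto_def row_coeff_def .
  then show ?thesis
    using assms by (simp add: fradeco_matrix_def index_shift_shifted_form)
qed

lemma fradeco_matrix_dim: "dim_row (fradeco_matrix r d) = r - 1" "dim_col (fradeco_matrix r d) = d - r + 1"
  by (simp_all add: fradeco_matrix_def)

lemma fradeco_submatrix:
  assumes r: "r \<in> {3..9}" and J: "J \<subseteq> {..<d - r + 1}" "card J = r - 1"
  shows "submatrix (fradeco_matrix r d) UNIV J \<in> carrier_mat (r - 1) (r - 1)"
    and "k < r - 1 \<Longrightarrow> pick J k < d - r + 1"
    and "i < r - 1 \<Longrightarrow> k < r - 1 \<Longrightarrow>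
      submatrix (fradeco_matrix r d) UNIV J $$ (i, k) = shifted_form (row_coeff r i) r (pick J k)"
proof -
  have J': "{j. j < d - r + 1 \<and> j \<in> J} = J" using J(1) by auto
  show "submatrix (fradeco_matrix r d) UNIV J \<in> carrier_mat (r - 1) (r - 1)"
    unfolding submatrix_def fradeco_matrix_dim J' J(2) by simp
  show p: "pick J k < d - r + 1" if "k < r - 1" for k
    using pick_in_set_le[of k J] that J by auto
  show "submatrix (fradeco_matrix r d) UNIV J $$ (i, k) = shifted_form (row_coeff r i) r (pick J k)"
    if "i < r - 1" "k < r - 1"
    using that fradeco_matrix_entry[OF r that(1) p[OF that(2)]]
    by (subst submatrix_index) (simp_all add: fradeco_matrix_dim J'[simplified] J(2) pick_UNIV)
qed

text \<open>The form \<open>p\<close> with the frame directions as roots annihilates every window of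
  \<open>r + 1\<close> consecutive coordinates. As \<open>p\<close> is a combination of the rows,
  its coefficients \<open>c\<close> are a left kernel vector of the evaluated matrix, whatever
  columns are selected.\<close>

lemma minor_vanishes_on_frames:
  assumes r: "r \<in> {3..9}" and d: "r \<le> d" and V: "V \<in> funtf_variety r 2"
    and J: "J \<subseteq> {..<d - r + 1}" "card J = r - 1"
    and v: "\<And>i. i \<le> d \<Longrightarrow> v $ i = (\<Sum>k<r. lam k * (V $$ (0, k)) ^ i * (V $$ (1, k)) ^ (d - i))"
  shows "eval_at (det (submatrix (fradeco_matrix r d) UNIV J)) v = 0"
proof -
  define x where "x k = V $$ (0, k)" for k
  define y where "y k = V $$ (1, k)" for k
  have VV: "V \<in> carrier_mat 2 r" "V * transpose_mat V = (of_nat r / 2) \<cdot>\<^sub>m 1\<^sub>m 2"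
    and unit: "\<And>j. j < r \<Longrightarrow> (\<Sum>i<2. (V $$ (i, j))\<^sup>2) = 1"
    using V by (auto simp: funtf_variety_def)
  have unit: "(x j)\<^sup>2 + (y j)\<^sup>2 = 1" if "j < r" for j
    using unit[OF that] by (simp add: x_def y_def eval_nat_numeral)
  have entry: "(V * transpose_mat V) $$ (a, b) = (\<Sum>k<r. V $$ (a, k) * V $$ (b, k))" if "a < 2" "b < 2" for a b
    using VV(1) that by (simp add: scalar_prod_def atLeast0LessThan)
  have xx: "(\<Sum>k<r. (x k)\<^sup>2) = of_nat r / 2" and xy: "(\<Sum>k<r. x k * y k) = 0"
    and yy: "(\<Sum>k<r. (y k)\<^sup>2) = of_nat r / 2"
    using entry[of 0 0] entry[of 0 1] entry[of 1 1] unfolding VV(2) x_def y_def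
    by (simp_all add: power2_eq_square)
  have isotropic: "(\<Sum>j<r. (x j + z * y j)\<^sup>2) = 0" if "z\<^sup>2 = -1" for z
  proof -
    have "(\<Sum>j<r. (x j + z * y j)\<^sup>2) = (\<Sum>j<r. (x j)\<^sup>2) + z\<^sup>2 * (\<Sum>j<r. (y j)\<^sup>2) + 2 * z * (\<Sum>j<r. x j * y j)"
      by (simp add: sum_distrib_left power2_eq_square algebra_simps flip: sum.distrib)
    then show ?thesis unfolding xx xy yy that by simp
  qed
  define p where "p = (\<Prod>j<r. [:- x j, y j:])"
  obtain c where c: "\<And>l. l \<le> r \<Longrightarrow> coeff p l = (\<Sum>i<r - 1. c i * row_coeff r i l)"
    using row_combination[OF r, of "coeff p"] tight_functional_prod_linear[of \<i> r x y]
      tight_functional_prod_linear[of "- \<i>" r x y] unit isotropic[of \<i>] isotropic[of "- \<i>"]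
    unfolding p_def by auto
  \<comment> \<open>A unit vector is nonzero, so no factor of \<open>p\<close> is zero. A nonzero
    coefficient of \<open>p\<close> then yields a nonzero \<open>c i0\<close>.\<close>
  have "[:- x j, y j:] \<noteq> 0" if "j < r" for j
    using unit[OF that] by auto
  then have "p \<noteq> 0"
    unfolding p_def by (simp add: prod_zero_iff)
  then have "coeff p (degree p) \<noteq> 0" by simp
  moreover have "degree p \<le> r" unfolding p_def using degree_prod_linear[of "{..<r}" x y] by simp
  ultimately obtain i0 where i0: "i0 < r - 1" "c i0 \<noteq> 0"
    using c[of "degree p"] by (auto elim: sum.not_neutral_contains_not_neutral)
  have kernel: "(\<Sum>i<r - 1. c i * eval_at (shifted_form (row_coeff r i) r j) v) = 0" if j: "j < d - r + 1" for j
  proof -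
    have "(\<Sum>i<r - 1. c i * eval_at (shifted_form (row_coeff r i) r j) v)
        = (\<Sum>i<r - 1. \<Sum>l\<le>r. (c i * row_coeff r i l) * v $ (l + j))"
      by (simp add: eval_shifted_form sum_distrib_left mult.assoc)
    also have "\<dots> = (\<Sum>l\<le>r. \<Sum>i<r - 1. (c i * row_coeff r i l) * v $ (l + j))"
      by (rule sum.swap)
    also have "\<dots> = (\<Sum>l\<le>r. coeff p l * v $ (l + j))"
      by (intro sum.cong) (simp_all add: c sum_distrib_right)
    also have "\<dots> = (\<Sum>l\<le>r. \<Sum>k<r. (lam k * x k ^ j * y k ^ (d - r - j)) * (coeff p l * x k ^ l * y k ^ (r - l)))"
    proof (intro sum.cong refl)
      fix l assume "l \<in> {..r}"
      then have l: "l \<le> r" by simp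
      \<comment> \<open>This splitting lets \<open>x k ^ j * y k ^ (d - r - j)\<close> be pulled
        out. What remains is \<open>p\<close>, homogenized, at its own root
        \<open>(x k, y k)\<close>.\<close>
      then have e: "d - (l + j) = (d - r - j) + (r - l)" "l + j \<le> d" using j d by auto
      have "v $ (l + j) = (\<Sum>k<r. lam k * x k ^ (l + j) * y k ^ ((d - r - j) + (r - l)))"
        unfolding x_def y_def e(1)[symmetric] by (rule v[OF e(2)])
      then show "coeff p l * v $ (l + j) = (\<Sum>k<r. (lam k * x k ^ j * y k ^ (d - r - j)) * (coeff p l * x k ^ l * y k ^ (r - l)))"
        by (simp add: sum_distrib_left power_add mult_ac)
    qed
    also have "\<dots> = (\<Sum>k<r. (lam k * x k ^ j * y k ^ (d - r - j)) * (\<Sum>l\<le>r. coeff p l * x k ^ l * y k ^ (r - l)))"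
      unfolding sum_distrib_left by (rule sum.swap)
    also have "\<dots> = 0"
    proof (intro sum.neutral ballI)
      fix k assume "k \<in> {..<r}"
      have "(\<Sum>l\<le>r. coeff p l * x k ^ l * y k ^ (r - l)) = (\<Prod>j<r. y j * x k - x j * y k)"
        unfolding p_def using homogenized_prod_linear[of "{..<r}" x y "x k" "y k"] by simp
      also have "\<dots> = 0"
        using \<open>k \<in> {..<r}\<close> by (intro prod_zero) (auto intro!: bexI[of _ k])
      finally show "(lam k * x k ^ j * y k ^ (d - r - j)) * (\<Sum>l\<le>r. coeff p l * x k ^ l * y k ^ (r - l)) = 0" by simp
    qed
    finally show ?thesis .
  qed
  let ?S = "submatrix (fradeco_matrix r d) UNIV J"
  note S = fradeco_submatrix(1)[OF r J] and S_entry = fradeco_submatrix(3)[OF r J]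
  let ?E = "map_mat (\<lambda>f. eval_at f v) ?S"
  have E: "?E \<in> carrier_mat (r - 1) (r - 1)" using S by simp
  have "transpose_mat ?E *\<^sub>v vec (r - 1) c = 0\<^sub>v (r - 1)"
  proof (rule eq_vecI)
    fix k assume "k < dim_vec (0\<^sub>v (r - 1) :: complex vec)"
    then have k: "k < r - 1" by simp
    show "(transpose_mat ?E *\<^sub>v vec (r - 1) c) $ k = 0\<^sub>v (r - 1) $ k"
      using k S kernel[OF fradeco_submatrix(2)[OF r J k]]
      by (simp add: scalar_prod_def S_entry atLeast0LessThan mult.commute)
  qed (use S in simp)
  moreover have "vec (r - 1) c \<noteq> 0\<^sub>v (r - 1)"
    using i0 by (auto dest!: arg_cong[where f = "\<lambda>v. v $ i0"])
  ultimately have "det (transpose_mat ?E) = 0"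
    using det_0_iff_vec_prod_zero[of "transpose_mat ?E" "r - 1"] E
    by (meson transpose_carrier_mat vec_carrier)
  then have "det ?E = 0" using det_transpose[OF E] by simp
  then show ?thesis using comm_ring_hom.hom_det[OF comm_ring_hom_eval_at, of v ?S] by simp
qed

section \<open>Tensors of frames with prescribed directions\<close>

lemma generators_in_fradeco_variety:
  assumes "V \<in> funtf_variety r 2" "binary_coords d (frame_tensor V lam) \<noteq> 0\<^sub>v (d + 1)"
  shows "proj_point (binary_coords d (frame_tensor V lam)) \<in> fradeco_variety r d"
  unfolding fradeco_variety_def by (rule subsetD[OF hull_subset]) (use assms in blast)

text \<open>Each direction \<open>(a j : b j)\<close> is rescaled to a vector of norm \<open>1\<close>, so the two sum conditions
  express tightness of the frame.\<close>

lemma vanishing_ideal_eval: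
  assumes f: "f \<in> vanishing_ideal d (fradeco_variety r d)"
    and nz: "\<And>j. j < r \<Longrightarrow> (a j)\<^sup>2 + (b j)\<^sup>2 \<noteq> 0"
    and ab: "(\<Sum>j<r. a j * b j / ((a j)\<^sup>2 + (b j)\<^sup>2)) = 0"
    and diff: "(\<Sum>j<r. ((a j)\<^sup>2 - (b j)\<^sup>2) / ((a j)\<^sup>2 + (b j)\<^sup>2)) = 0"
    and t: "t = vec (d + 1) (\<lambda>i. \<Sum>j<r. l j * a j ^ i * b j ^ (d - i))" and t0: "t \<noteq> 0\<^sub>v (d + 1)"
  shows "eval_at f t = 0"
proof -
  \<comment> \<open>The quadratic form is complex, so the length is a complex square root. It is
    nonzero because the direction is not isotropic.\<close>
  define n where "n j = csqrt ((a j)\<^sup>2 + (b j)\<^sup>2)" for j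
  have n: "(n j)\<^sup>2 = (a j)\<^sup>2 + (b j)\<^sup>2" for j by (simp add: n_def)
  have n0: "n j \<noteq> 0" if "j < r" for j using nz[OF that] by (simp add: n_def)
  define V where "V = mat 2 r (\<lambda>(i, j). (if i = 0 then a j else b j) / n j)"
  have V: "V \<in> carrier_mat 2 r" by (simp add: V_def)
  have total: "(\<Sum>j<r. (a j)\<^sup>2 / ((a j)\<^sup>2 + (b j)\<^sup>2)) + (\<Sum>j<r. (b j)\<^sup>2 / ((a j)\<^sup>2 + (b j)\<^sup>2)) = of_nat r"
    using nz by (simp flip: sum.distrib add_divide_distrib)
  have eq: "(\<Sum>j<r. (a j)\<^sup>2 / ((a j)\<^sup>2 + (b j)\<^sup>2)) - (\<Sum>j<r. (b j)\<^sup>2 / ((a j)\<^sup>2 + (b j)\<^sup>2)) = 0"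
    using diff by (simp add: diff_divide_distrib sum_subtractf)
  have aa: "(\<Sum>j<r. (a j)\<^sup>2 / ((a j)\<^sup>2 + (b j)\<^sup>2)) = of_nat r / 2"
    and bb: "(\<Sum>j<r. (b j)\<^sup>2 / ((a j)\<^sup>2 + (b j)\<^sup>2)) = of_nat r / 2"
    using total eq by (auto simp: field_simps)
  have "V * transpose_mat V = (of_nat r / of_nat 2) \<cdot>\<^sub>m 1\<^sub>m 2"
  proof (rule eq_matI)
    fix i k
    assume "i < dim_row ((of_nat r / of_nat 2) \<cdot>\<^sub>m 1\<^sub>m 2 :: complex mat)"
      "k < dim_col ((of_nat r / of_nat 2) \<cdot>\<^sub>m 1\<^sub>m 2 :: complex mat)"
    then have ik: "i = 0 \<or> i = 1" "k = 0 \<or> k = 1" "i < 2" "k < 2" by auto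
    have "(V * transpose_mat V) $$ (i, k)
        = (\<Sum>j<r. (if i = 0 then a j else b j) * (if k = 0 then a j else b j) / ((a j)\<^sup>2 + (b j)\<^sup>2))"
      using ik(3,4) by (simp add: V_def scalar_prod_def atLeast0LessThan power2_eq_square[of "n _"] flip: n)
    then show "(V * transpose_mat V) $$ (i, k) = ((of_nat r / of_nat 2) \<cdot>\<^sub>m 1\<^sub>m 2) $$ (i, k)"
      using ik aa bb ab by (auto simp: power2_eq_square[of "a _"] power2_eq_square[of "b _"] mult.commute)
  qed (simp_all add: V_def)
  moreover have "(\<Sum>i<2. (V $$ (i, j))\<^sup>2) = 1" if "j < r" for j
    using that nz[OF that] by (simp add: V_def eval_nat_numeral power_divide n[unfolded power2_eq_square] flip: add_divide_distrib)
  ultimately have VF: "V \<in> funtf_variety r 2" using V by (simp add: funtf_variety_def)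
  \<comment> \<open>The power of a direction is homogeneous of degree \<open>d\<close>, so the
    factor \<open>n j ^ d\<close> in the coefficient undoes the normalization.\<close>
  have "t = binary_coords d (frame_tensor V (\<lambda>j. l j * n j ^ d))"
  proof (rule eq_vecI)
    fix i assume "i < dim_vec (binary_coords d (frame_tensor V (\<lambda>j. l j * n j ^ d)))"
    then have i: "i \<le> d" by (simp add: binary_coords_def)
    have scaled: "l j * n j ^ d * (a j / n j) ^ i * (b j / n j) ^ (d - i) = l j * a j ^ i * b j ^ (d - i)" if "j < r" for j
      using i n0[OF that] power_add[of "n j" i "d - i"] by (simp add: power_divide)
    have "(\<Sum>j<r. l j * a j ^ i * b j ^ (d - i))
        = (\<Sum>j<r. l j * n j ^ d * (a j / n j) ^ i * (b j / n j) ^ (d - i))"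
      by (intro sum.cong refl scaled[symmetric]) simp
    then show "t $ i = binary_coords d (frame_tensor V (\<lambda>j. l j * n j ^ d)) $ i"
      unfolding binary_coords_frame_tensor[OF V i] t using i by (simp add: V_def)
  qed (simp add: t binary_coords_def)
  then have "proj_point t \<in> fradeco_variety r d"
    using generators_in_fradeco_variety[OF VF, of d] t0 by metis
  moreover have "t \<in> proj_point t"
    unfolding proj_point_def by (rule CollectI, rule exI[of _ 1]) simp
  ultimately show ?thesis
    using f unfolding vanishing_ideal_def vanishes_at_def by blast
qed

text \<open>The roots of a real quadratic. The discriminant may be negative, so the pair can be
  non-real even though the data are real.\<close>

lemma complex_pair_with_sum_and_product:
  fixes P R :: real
  obtains p q :: complex where "p + q = of_real P" "p * q = of_real R"
    "p = q \<longleftrightarrow> P\<^sup>2 = 4 * R"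
proof -
  define s where "s = csqrt (of_real (P\<^sup>2 - 4 * R))"
  have s2: "s\<^sup>2 = of_real (P\<^sup>2 - 4 * R)" by (simp add: s_def)
  have "(of_real P + s) / 2 * ((of_real P - s) / 2) = (of_real (P\<^sup>2) - s\<^sup>2) / 4"
    by (simp add: power2_eq_square algebra_simps)
  then have "(of_real P + s) / 2 * ((of_real P - s) / 2) = of_real R" unfolding s2 by simp
  moreover have "(of_real P + s) / 2 = (of_real P - s) / 2 \<longleftrightarrow> s = 0" by auto
  moreover have "s = 0 \<longleftrightarrow> P\<^sup>2 - 4 * R = 0" unfolding s_def by (metis csqrt_eq_0 of_real_eq_0_iff)
  ultimately show thesis
    by (intro that[of "(of_real P + s) / 2" "(of_real P - s) / 2"]) (auto simp: field_simps)
qed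

text \<open>In terms of \<open>P = p + q\<close> and \<open>R = p q\<close>, the two equations are \<open>P (1 + R) = - \<epsilon> D\<close> and
  \<open>2 (1 - R\<^sup>2) = \<kappa> D\<close> with \<open>D = P\<^sup>2 + (1 - R)\<^sup>2\<close>, which determines \<open>P\<close> and \<open>R\<close>.\<close>

lemma balancing_pair:
  fixes \<epsilon> \<kappa> g P R :: real
  assumes "\<kappa> > 0" and g: "g = \<kappa> + 4 * \<epsilon>\<^sup>2 / \<kappa>"
    and R: "R = (g - 2) / (g + 2)" and P: "P = - 8 * \<epsilon> / (\<kappa> * (g + 2))"
    and pq: "p + q = of_real P" "p * q = (of_real R :: complex)"
  shows "1 + p\<^sup>2 \<noteq> 0" "1 + q\<^sup>2 \<noteq> 0" "p / (1 + p\<^sup>2) + q / (1 + q\<^sup>2) = - of_real \<epsilon>"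
    "(1 - p\<^sup>2) / (1 + p\<^sup>2) + (1 - q\<^sup>2) / (1 + q\<^sup>2) = of_real \<kappa>"
proof -
  have g0: "g > 0" unfolding g using assms(1) by (simp add: add_pos_nonneg)
  \<comment> \<open>This is \<open>(1 + p\<^sup>2) * (1 + q\<^sup>2)\<close> in terms of sum and
    product. The choice of \<open>g\<close> makes
    \<open>4 * \<epsilon>\<^sup>2 / \<kappa>\<^sup>2 + 1 = g / \<kappa>\<close>, which gives
    \<open>D\<close> its closed form.\<close>
  define D where "D = P\<^sup>2 + (1 - R)\<^sup>2"
  have R1: "1 - R = 4 / (g + 2)" "1 + R = 2 * g / (g + 2)" unfolding R using g0 by (auto simp: field_simps)
  have "16 / (g + 2)\<^sup>2 * (4 * \<epsilon>\<^sup>2 / \<kappa>\<^sup>2 + 1) = 16 / (g + 2)\<^sup>2 * (g / \<kappa>)"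
    unfolding g using assms(1) by (simp add: field_simps power2_eq_square)
  moreover have P2: "P\<^sup>2 = 64 * \<epsilon>\<^sup>2 / (\<kappa>\<^sup>2 * (g + 2)\<^sup>2)"
    unfolding P by (simp add: power_divide power_mult_distrib)
  ultimately have D: "D = 16 * g / (\<kappa> * (g + 2)\<^sup>2)"
    unfolding D_def R1 P2 by (simp add: power_divide distrib_left mult_ac)
  have D0: "D \<noteq> 0" unfolding D using g0 assms(1) by simp
  have e1: "P * (1 + R) = - \<epsilon> * D"
    unfolding D R1 P by (simp add: power2_eq_square mult_ac)
  have e2: "2 * (1 - R) * (1 + R) = \<kappa> * D"
    unfolding D R1 using assms(1) by (simp add: power2_eq_square mult_ac)
  have prod: "(1 + p\<^sup>2) * (1 + q\<^sup>2) = of_real D"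
  proof -
    have "(1 + p\<^sup>2) * (1 + q\<^sup>2) = (p + q)\<^sup>2 + (1 - p * q)\<^sup>2" by (simp add: power2_eq_square algebra_simps)
    then show ?thesis unfolding pq D_def by simp
  qed
  then show nz: "1 + p\<^sup>2 \<noteq> 0" "1 + q\<^sup>2 \<noteq> 0" using D0 by auto
  have "p / (1 + p\<^sup>2) + q / (1 + q\<^sup>2) = (p * (1 + q\<^sup>2) + q * (1 + p\<^sup>2)) / ((1 + p\<^sup>2) * (1 + q\<^sup>2))"
    using nz by (simp add: add_frac_eq)
  also have "p * (1 + q\<^sup>2) + q * (1 + p\<^sup>2) = (p + q) * (1 + p * q)"
    by (simp add: power2_eq_square algebra_simps)
  also have "\<dots> = of_real (P * (1 + R))" unfolding pq by simp
  finally show "p / (1 + p\<^sup>2) + q / (1 + q\<^sup>2) = - of_real \<epsilon>"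
    unfolding prod e1 using D0 by simp
  have "(1 - p\<^sup>2) / (1 + p\<^sup>2) + (1 - q\<^sup>2) / (1 + q\<^sup>2)
      = ((1 - p\<^sup>2) * (1 + q\<^sup>2) + (1 - q\<^sup>2) * (1 + p\<^sup>2)) / ((1 + p\<^sup>2) * (1 + q\<^sup>2))"
    using nz by (simp add: add_frac_eq)
  also have "(1 - p\<^sup>2) * (1 + q\<^sup>2) + (1 - q\<^sup>2) * (1 + p\<^sup>2) = 2 * (1 - p * q) * (1 + p * q)"
    by (simp add: power2_eq_square algebra_simps)
  also have "\<dots> = of_real (2 * (1 - R) * (1 + R))" unfolding pq by simp
  finally show "(1 - p\<^sup>2) / (1 + p\<^sup>2) + (1 - q\<^sup>2) / (1 + q\<^sup>2) = of_real \<kappa>"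
    unfolding prod e2 using D0 by simp
qed

text \<open>For \<open>h = 2\<close> the general pair degenerates in the limit to \<open>p = q = 0\<close>; there the frame consists of
  two orthonormal bases, so the slopes are explicit.\<close>

lemma eventually_balancing_pair:
  fixes \<rho> :: "nat \<Rightarrow> real \<Rightarrow> real"
  assumes h: "h \<ge> 1" and lim: "\<And>j. j < h \<Longrightarrow> (\<rho> j \<longlongrightarrow> 0) at_top"
    and distinct: "\<And>i j. i < h \<Longrightarrow> j < h \<Longrightarrow> i \<noteq> j \<Longrightarrow> eventually (\<lambda>L. \<rho> i L \<noteq> \<rho> j L) at_top"
  shows "eventually (\<lambda>L. \<exists>p q :: complex. p \<noteq> q \<and> norm (p + q) \<le> 1 \<and> norm (p * q) \<le> 1 \<and>
      1 + p\<^sup>2 \<noteq> 0 \<and> 1 + q\<^sup>2 \<noteq> 0 \<and>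
      p / (1 + p\<^sup>2) + q / (1 + q\<^sup>2) = - of_real (\<Sum>j<h. \<rho> j L / (1 + (\<rho> j L)\<^sup>2)) \<and>
      (1 - p\<^sup>2) / (1 + p\<^sup>2) + (1 - q\<^sup>2) / (1 + q\<^sup>2)
        = of_real (\<Sum>j<h. (1 - (\<rho> j L)\<^sup>2) / (1 + (\<rho> j L)\<^sup>2))) at_top"
proof (cases "h = 2")
  case True
  have pos: "1 + (of_real x :: complex)\<^sup>2 \<noteq> 0" for x :: real
  proof -
    have "1 + x\<^sup>2 > 0" by (simp add: add_pos_nonneg)
    then have "1 + x\<^sup>2 \<noteq> 0" by simp
    then show ?thesis by (metis of_real_1 of_real_add of_real_eq_0_iff of_real_power)
  qed
  have small: "eventually (\<lambda>L. \<bar>\<rho> j L\<bar> < 1 / 2) at_top" if "j < h" for j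
    using tendstoD[OF lim[OF that], of "1 / 2"] by (simp add: dist_real_def)
  have "eventually (\<lambda>L. \<bar>\<rho> 0 L\<bar> < 1 / 2 \<and> \<bar>\<rho> 1 L\<bar> < 1 / 2 \<and> \<rho> 0 L \<noteq> \<rho> 1 L) at_top"
    using small distinct[of 0 1] True by (auto intro!: eventually_conj)
  then show ?thesis
  proof eventually_elim
    case (elim L)
    have S: "{..<h} = {0, 1}" using True by auto
    show ?case
    \<comment> \<open>The vectors \<open>(\<rho>, 1)\<close> and \<open>(1, - \<rho>)\<close> are
      orthogonal, so each slope is balanced by its own negative.\<close>
    proof (rule exI[of _ "- of_real (\<rho> 0 L)"], rule exI[of _ "- of_real (\<rho> 1 L)"], intro conjI)
      have "norm (- of_real (\<rho> 0 L) + - of_real (\<rho> 1 L) :: complex) = \<bar>- \<rho> 0 L + - \<rho> 1 L\<bar>"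
        by (metis norm_of_real of_real_add of_real_minus)
      then show "norm (- of_real (\<rho> 0 L) + - of_real (\<rho> 1 L) :: complex) \<le> 1" using elim by linarith
      have "\<bar>\<rho> 0 L\<bar> * \<bar>\<rho> 1 L\<bar> \<le> 1 * 1" using elim by (intro mult_mono) auto
      then show "norm (- of_real (\<rho> 0 L) * - of_real (\<rho> 1 L) :: complex) \<le> 1"
        by (simp add: norm_mult)
    qed (use elim pos in \<open>simp_all add: S\<close>)
  qed
next
  case False
  define \<epsilon> where "\<epsilon> L = (\<Sum>j<h. \<rho> j L / (1 + (\<rho> j L)\<^sup>2))" for L
  define \<kappa> where "\<kappa> L = (\<Sum>j<h. (1 - (\<rho> j L)\<^sup>2) / (1 + (\<rho> j L)\<^sup>2))" for L
  define g where "g L = \<kappa> L + 4 * (\<epsilon> L)\<^sup>2 / \<kappa> L" for L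
  define R where "R L = (g L - 2) / (g L + 2)" for L
  define P where "P L = - 8 * \<epsilon> L / (\<kappa> L * (g L + 2))" for L
  have h0: "real h > 0" using h by simp
  have "(\<epsilon> \<longlongrightarrow> (\<Sum>j<h. 0 / (1 + 0\<^sup>2))) at_top"
    unfolding \<epsilon>_def by (intro tendsto_intros lim) auto
  then have \<epsilon>: "(\<epsilon> \<longlongrightarrow> 0) at_top" by simp
  have "(\<kappa> \<longlongrightarrow> (\<Sum>j<h. (1 - 0\<^sup>2) / (1 + 0\<^sup>2))) at_top"
    unfolding \<kappa>_def by (intro tendsto_intros lim) auto
  then have \<kappa>: "(\<kappa> \<longlongrightarrow> real h) at_top" by simp
  have "(g \<longlongrightarrow> real h + 4 * 0\<^sup>2 / real h) at_top"
    unfolding g_def by (intro tendsto_intros \<epsilon> \<kappa>) (use h0 in auto)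
  then have g: "(g \<longlongrightarrow> real h) at_top" by simp
  have R: "(R \<longlongrightarrow> (real h - 2) / (real h + 2)) at_top"
    unfolding R_def by (intro tendsto_intros g) (use h0 in auto)
  have "(P \<longlongrightarrow> - 8 * 0 / (real h * (real h + 2))) at_top"
    unfolding P_def by (intro tendsto_intros g \<epsilon> \<kappa>) (use h0 in auto)
  then have P: "(P \<longlongrightarrow> 0) at_top" by simp
  \<comment> \<open>The discriminant of the pair has a nonzero limit exactly when \<open>h\<close>
    is not 2, so \<open>p\<close> and \<open>q\<close> are eventually distinct.\<close>
  have "((\<lambda>L. (P L)\<^sup>2 - 4 * R L) \<longlongrightarrow> 0\<^sup>2 - 4 * ((real h - 2) / (real h + 2))) at_top"
    by (intro tendsto_intros P R)
  moreover have "0\<^sup>2 - 4 * ((real h - 2) / (real h + 2)) \<noteq> 0" using False h0 by simp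
  ultimately have ev1: "eventually (\<lambda>L. (P L)\<^sup>2 - 4 * R L \<noteq> 0) at_top"
    by (rule tendsto_imp_eventually_ne)
  have ev2: "eventually (\<lambda>L. \<bar>P L\<bar> < 1) at_top"
    using tendstoD[OF P, of 1] by (simp add: dist_real_def)
  have ev3: "eventually (\<lambda>L. \<kappa> L > 0) at_top" using order_tendstoD(1)[OF \<kappa> h0] .
  from ev1 ev2 ev3 show ?thesis
  proof eventually_elim
    case (elim L)
    obtain p q :: complex where pq: "p + q = of_real (P L)" "p * q = of_real (R L)" "p = q \<longleftrightarrow> (P L)\<^sup>2 = 4 * R L"
      using complex_pair_with_sum_and_product by blast
    have "g L > 0" unfolding g_def using elim(3) by (simp add: add_pos_nonneg)
    then have "\<bar>R L\<bar> \<le> 1" unfolding R_def by (simp add: field_simps abs_le_iff)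
    then show ?case
      using balancing_pair[OF elim(3) g_def R_def P_def pq(1,2)] pq elim
      unfolding \<epsilon>_def[symmetric] \<kappa>_def[symmetric]
      by - (rule exI[of _ p], rule exI[of _ q], simp)
  qed
qed

section \<open>A degenerating family of tensors\<close>

text \<open>The drops \<open>w k - w (Suc k)\<close> do not increase with \<open>k\<close>. Walking
  from \<open>b\<close> in either direction, each step therefore stays on or above the line through
  the values at \<open>b\<close> and \<open>b + 1\<close>.\<close>

lemma convex_above_tangent:
  fixes w :: "nat \<Rightarrow> real"
  assumes convex: "\<And>i. Suc i < d \<Longrightarrow> w (Suc i) - w (Suc (Suc i)) \<le> w i - w (Suc i)"
    and "b < d" "i \<le> d"
  shows "w b + (real b - real i) * (w b - w (Suc b)) \<le> w i"
proof -
  have mono: "w k - w (Suc k) \<le> w j - w (Suc j)" if "j \<le> k" "k < d" for j k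
    using that
  proof (induction k rule: dec_induct)
    case (step k)
    then show ?case using convex[of k] by linarith
  qed simp
  show ?thesis
  proof (cases "b \<le> i")
    case True
    then show ?thesis using assms(3)
    proof (induction i rule: dec_induct)
      case (step i)
      then have "w b + (real b - real i) * (w b - w (Suc b)) \<le> w i" by simp
      moreover have "w i - w (Suc i) \<le> w b - w (Suc b)" using mono[of b i] step by simp
      ultimately show ?case by (simp add: algebra_simps)
    qed simp
  next
    case False
    then have "i \<le> b" by simp
    then show ?thesis
    proof (induction i rule: inc_induct)
      case (step i)
      have "w b - w (Suc b) \<le> w i - w (Suc i)" using mono[of i b] step assms(2) by simp
      then show ?case using step.IH by (simp add: algebra_simps)
    qed simp
  qed
qed

lemma tendsto_exp_decay:
  fixes c :: real
  assumes "c > 0"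
  shows "((\<lambda>L. exp (- (L * c))) \<longlongrightarrow> 0) at_top"
proof -
  have "filterlim (\<lambda>L. L * c) at_top at_top"
    using assms by (intro filterlim_at_top_mult_tendsto_pos[OF tendsto_const] filterlim_ident)
  then have "filterlim (\<lambda>L. - (L * c)) at_bot at_top"
    by (simp add: filterlim_uminus_at_top)
  then show ?thesis by (rule filterlim_compose[OF exp_at_bot])
qed

text \<open>Meant for \<open>\<mu> * p ^ k + \<nu> * q ^ k\<close>. A bound through the coefficients
  would blow up when \<open>p\<close> and \<open>q\<close> approach each other, while the recurrence
  involves only their sum and product and the two initial values.\<close>

lemma linear_recurrence_bound:
  fixes u :: "nat \<Rightarrow> complex"
  assumes rec: "\<And>k. u (Suc (Suc k)) = P * u (Suc k) - R * u k"
    and "norm P \<le> 1" "norm R \<le> 1" "norm (u 0) \<le> E" "norm (u 1) \<le> E"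
  shows "norm (u k) \<le> 2 ^ k * E"
proof -
  have E: "0 \<le> E" using assms(4) norm_ge_zero order_trans by blast
  have "norm (u k) \<le> 2 ^ k * E \<and> norm (u (Suc k)) \<le> 2 ^ Suc k * E"
  proof (induction k)
    case 0
    then show ?case using assms(4,5) E by simp
  next
    case (Suc k)
    have "norm (u (Suc (Suc k))) \<le> norm P * norm (u (Suc k)) + norm R * norm (u k)"
      unfolding rec by (metis norm_mult norm_triangle_ineq4)
    also have "\<dots> \<le> 1 * norm (u (Suc k)) + 1 * norm (u k)"
      using assms(2,3) by (intro add_mono mult_right_mono) auto
    also have "\<dots> \<le> 2 ^ Suc k * E + 2 ^ k * E"
      using add_mono[OF conjunct2[OF Suc] conjunct1[OF Suc]] by (simp only: mult_1)
    also have "\<dots> \<le> 2 ^ Suc (Suc k) * E" using E by (simp add: algebra_simps)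
    finally show ?case using Suc by simp
  qed
  then show ?thesis by blast
qed

text \<open>The curve behind the Groebner property: \<open>t\<^sub>i\<close> is a sum of \<open>h\<close> exponentials, one for each tangent
  line of the convex function \<open>w\<close> at the edges \<open>{\<beta> j, \<beta> j + 1}\<close>, plus the contribution of the
  two balancing directions, whose coefficients are used to prescribe \<open>t\<^sub>d\<close> and \<open>t\<^sub>d\<^sub>-\<^sub>1\<close>.\<close>

lemma degenerating_tensors:
  fixes w :: "nat \<Rightarrow> real" and \<beta> :: "nat \<Rightarrow> nat"
  assumes f: "f \<in> vanishing_ideal d (fradeco_variety (h + 2) d)" and h: "h \<ge> 1" and d: "d \<ge> 2"
    and decreasing: "\<And>i. i < d \<Longrightarrow> w (Suc i) < w i"
    and convex: "\<And>i. Suc i < d \<Longrightarrow> w (Suc i) - w (Suc (Suc i)) < w i - w (Suc i)"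
    and \<beta>: "inj_on \<beta> {..<h}" "\<And>j. j < h \<Longrightarrow> \<beta> j + 2 \<le> d"
  shows "eventually (\<lambda>L. \<exists>t. eval_at f t = 0 \<and>
      (\<forall>i\<le>d. norm (t $ i) \<le> (real h + 2 ^ d * (1 + real h)) * exp (L * w i)) \<and>
      (\<forall>i\<le>d. i = d \<or> i = d - 1 \<or> (\<exists>j<h. i = \<beta> j \<or> i = Suc (\<beta> j)) \<longrightarrow>
        exp (L * w i) / 2 \<le> norm (t $ i))) at_top"
proof -
  define \<delta> where "\<delta> b = w b - w (Suc b)" for b
  have \<delta>_pos: "\<delta> b > 0" if "b < d" for b using decreasing[OF that] by (simp add: \<delta>_def)
  have \<delta>_step: "\<delta> (Suc i) < \<delta> i" if "Suc i < d" for i using convex[OF that] by (simp add: \<delta>_def)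
  have \<delta>_less: "\<delta> k < \<delta> j" if "j < k" "k < d" for j k
    using that
  proof (induction k)
    case (Suc k)
    then show ?case using \<delta>_step[of k] by (cases "j = k") auto
  qed simp
  have tangent: "w b + (real b - real i) * \<delta> b \<le> w i" if "b < d" "i \<le> d" for b i
    unfolding \<delta>_def by (rule convex_above_tangent[where d = d]) (use convex that less_imp_le in blast)+
  define \<rho> where "\<rho> j L = exp (- (L * \<delta> (\<beta> j)))" for j L
  have \<beta>d: "\<beta> j < d" if "j < h" for j using \<beta>(2)[OF that] by simp
  have "eventually (\<lambda>L. \<rho> i L \<noteq> \<rho> j L) at_top" if "i < h" "j < h" "i \<noteq> j" for i j
  proof -
    have "\<beta> i \<noteq> \<beta> j" using \<beta>(1) that by (auto dest: inj_onD)
    then have "\<delta> (\<beta> i) \<noteq> \<delta> (\<beta> j)"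
      using \<delta>_less[of "\<beta> i" "\<beta> j"] \<delta>_less[of "\<beta> j" "\<beta> i"] \<beta>d that by (metis less_irrefl nat_neq_iff)
    then have "\<rho> i L \<noteq> \<rho> j L" if "L > 0" for L
      using that by (simp add: \<rho>_def)
    then show ?thesis by (rule eventually_mono[OF eventually_gt_at_top[of 0]])
  qed
  then have pairs: "eventually (\<lambda>L. \<exists>p q :: complex. p \<noteq> q \<and> norm (p + q) \<le> 1 \<and> norm (p * q) \<le> 1 \<and>
      1 + p\<^sup>2 \<noteq> 0 \<and> 1 + q\<^sup>2 \<noteq> 0 \<and>
      p / (1 + p\<^sup>2) + q / (1 + q\<^sup>2) = - of_real (\<Sum>j<h. \<rho> j L / (1 + (\<rho> j L)\<^sup>2)) \<and>
      (1 - p\<^sup>2) / (1 + p\<^sup>2) + (1 - q\<^sup>2) / (1 + q\<^sup>2)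
        = of_real (\<Sum>j<h. (1 - (\<rho> j L)\<^sup>2) / (1 + (\<rho> j L)\<^sup>2))) at_top"
    using h \<delta>_pos \<beta>d by (intro eventually_balancing_pair) (auto simp: \<rho>_def intro!: tendsto_exp_decay)
  \<comment> \<open>\<open>M * exp (L * w (d - 1))\<close> will bound the balancing contribution at
    every coordinate. Against \<open>exp (L * w i)\<close> with \<open>i \<le> d - 2\<close> it is
    negligible for large \<open>L\<close>.\<close>
  define M where "M = 2 ^ d * (1 + real h)"
  have "((\<lambda>L. exp (- (L * \<delta> (d - 2))) * M) \<longlongrightarrow> 0 * M) at_top"
    using d by (intro tendsto_intros tendsto_exp_decay \<delta>_pos) simp
  then have small: "eventually (\<lambda>L. exp (- (L * \<delta> (d - 2))) * M < 1 / 2) at_top"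
    by (rule order_tendstoD(2)) simp
  from pairs small eventually_gt_at_top[of 0] show ?thesis
  proof eventually_elim
    case (elim L)
    from elim(1) obtain p q :: complex where pq: "p \<noteq> q" "norm (p + q) \<le> 1" "norm (p * q) \<le> 1"
      and nz: "1 + p\<^sup>2 \<noteq> 0" "1 + q\<^sup>2 \<noteq> 0"
      and sum1: "p / (1 + p\<^sup>2) + q / (1 + q\<^sup>2) = - of_real (\<Sum>j<h. \<rho> j L / (1 + (\<rho> j L)\<^sup>2))"
      and sum2: "(1 - p\<^sup>2) / (1 + p\<^sup>2) + (1 - q\<^sup>2) / (1 + q\<^sup>2)
        = of_real (\<Sum>j<h. (1 - (\<rho> j L)\<^sup>2) / (1 + (\<rho> j L)\<^sup>2))" by blast
    have L: "L > 0" using elim by simp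
    define W where "W i = exp (L * w i)" for i
    have W_pos: "W i > 0" for i by (simp add: W_def)
    have W_mono: "W i \<le> W j" if "j \<le> i" "i \<le> d" for i j
    proof -
      have "w i \<le> w j" using that
      proof (induction i rule: dec_induct)
        case (step i)
        then show ?case using decreasing[of i] by simp
      qed simp
      then show ?thesis using L by (simp add: W_def)
    qed
    \<comment> \<open>The exponential of the tangent line at \<open>\<beta> j\<close>. The line is
      affine in \<open>i\<close>, so this is a geometric sequence, that is, the contribution of one
      direction \<open>(\<rho> j L : 1)\<close>.\<close>
    define \<psi> where "\<psi> j i = exp (L * (w (\<beta> j) + (real (\<beta> j) - real i) * \<delta> (\<beta> j)))" for j i
    define lam where "lam j = exp (L * (w (\<beta> j) + real (\<beta> j) * \<delta> (\<beta> j)))" for j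
    have \<psi>: "\<psi> j i = lam j * \<rho> j L ^ i" for j i
    proof -
      have "L * (w (\<beta> j) + (real (\<beta> j) - real i) * \<delta> (\<beta> j))
          = L * (w (\<beta> j) + real (\<beta> j) * \<delta> (\<beta> j)) + real i * (- (L * \<delta> (\<beta> j)))"
        by (simp add: algebra_simps)
      then show ?thesis unfolding \<psi>_def lam_def \<rho>_def by (simp only: exp_add exp_of_nat_mult)
    qed
    have \<psi>_le: "\<psi> j i \<le> W i" if "j < h" "i \<le> d" for i j
      unfolding \<psi>_def W_def using tangent[OF \<beta>d[OF that(1)] that(2)] L by simp
    have \<psi>_eq: "\<psi> j i = W i" if "i = \<beta> j \<or> i = Suc (\<beta> j)" for i j
      using that unfolding \<psi>_def W_def \<delta>_def by (auto simp: algebra_simps)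
    have \<psi>_pos: "\<psi> j i > 0" for j i by (simp add: \<psi>_def)
    define T where "T i = (\<Sum>j<h. \<psi> j i)" for i
    have T_nonneg: "T i \<ge> 0" for i unfolding T_def using \<psi>_pos by (intro sum_nonneg) (simp add: less_imp_le)
    have T_le: "T i \<le> real h * W i" if "i \<le> d" for i
      unfolding T_def using sum_bounded_above[of "{..<h}" "\<lambda>j. \<psi> j i" "W i"] \<psi>_le that by simp
    \<comment> \<open>What the balancing pair must add at \<open>d\<close> and \<open>d - 1\<close>
      for these coordinates to equal \<open>W d\<close> and \<open>W (d - 1)\<close>.\<close>
    define e0 e1 where "e0 = (of_real (W d - T d) :: complex)" and "e1 = (of_real (W (d - 1) - T (d - 1)) :: complex)"
    have norm_e: "norm (of_real (W i - T i) :: complex) \<le> (1 + real h) * W i" if "i \<le> d" for i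
    proof -
      have "\<bar>W i - T i\<bar> \<le> W i + T i" using T_nonneg[of i] W_pos[of i] by (simp add: abs_le_iff)
      then show ?thesis using T_le[OF that] by (simp only: norm_of_real) (simp add: algebra_simps)
    qed
    \<comment> \<open>The solution of the Vandermonde system \<open>\<mu> + \<nu> = e0\<close>,
      \<open>\<mu> * p + \<nu> * q = e1\<close>, available because \<open>p\<close> and
      \<open>q\<close> differ.\<close>
    define \<nu> where "\<nu> = (e1 - p * e0) / (q - p)"
    define \<mu> where "\<mu> = e0 - \<nu>"
    define u where "u k = \<mu> * p ^ k + \<nu> * q ^ k" for k
    have u0: "u 0 = e0" by (simp add: u_def \<mu>_def)
    have "u 1 = p * e0 + \<nu> * (q - p)" by (simp add: u_def \<mu>_def algebra_simps)
    then have u1: "u 1 = e1" using pq(1) by (simp add: \<nu>_def)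
    have u_bound: "norm (u k) \<le> 2 ^ k * ((1 + real h) * W (d - 1))" for k
    proof (rule linear_recurrence_bound[of u "p + q" "p * q"])
      show "u (Suc (Suc k)) = (p + q) * u (Suc k) - p * q * u k" for k
        by (simp add: u_def algebra_simps)
      have "(1 + real h) * W d \<le> (1 + real h) * W (d - 1)"
        by (intro mult_left_mono W_mono) auto
      then show "norm (u 0) \<le> (1 + real h) * W (d - 1)"
        unfolding u0 e0_def by (rule order_trans[OF norm_e[OF order_refl]])
      show "norm (u 1) \<le> (1 + real h) * W (d - 1)"
        unfolding u1 e1_def by (rule norm_e) simp
    qed (use pq in auto)
    have u_bound: "norm (u k) \<le> M * W (d - 1)" if "k \<le> d" for k
    proof -
      have "2 ^ k * ((1 + real h) * W (d - 1)) \<le> 2 ^ d * ((1 + real h) * W (d - 1))"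
        using that W_pos by (intro mult_right_mono power_increasing) (auto simp: less_imp_le)
      then show ?thesis unfolding M_def mult.assoc by (rule order_trans[OF u_bound])
    qed
    \<comment> \<open>The balancing directions are \<open>(1 : p)\<close> and
      \<open>(1 : q)\<close>, so the powers of \<open>p\<close> and \<open>q\<close> count down from
      coordinate \<open>d\<close> and give \<open>u (d - i)\<close>.\<close>
    define a where "a j = (if j < h then of_real (\<rho> j L) else 1 :: complex)" for j
    define b where "b j = (if j < h then 1 else if j = h then p else q)" for j
    define l where "l j = (if j < h then of_real (lam j) else if j = h then \<mu> else \<nu>)" for j
    define t where "t = vec (d + 1) (\<lambda>i. \<Sum>j<h + 2. l j * a j ^ i * b j ^ (d - i))"
    have split: "(\<Sum>j<h + 2. F j) = (\<Sum>j<h. F j) + F h + F (Suc h)" for F :: "nat \<Rightarrow> complex"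
      by (simp add: eval_nat_numeral)
    have t: "t $ i = of_real (T i) + u (d - i)" if "i \<le> d" for i
    proof -
      have "(\<Sum>j<h. l j * a j ^ i * b j ^ (d - i)) = of_real (T i)"
        unfolding T_def \<psi> by (simp add: l_def a_def b_def)
      then show ?thesis
        using that unfolding t_def by (simp add: split[simplified] l_def a_def b_def u_def)
    qed
    have td: "t $ d = of_real (W d)" using t[of d] u0 by (simp add: e0_def)
    have td1: "t $ (d - 1) = of_real (W (d - 1))" using t[of "d - 1"] u1 d by (simp add: e1_def)
    have real_nz: "(of_real x :: complex)\<^sup>2 + 1 \<noteq> 0" for x :: real
    proof -
      have "x\<^sup>2 + 1 > 0" by (simp add: add_nonneg_pos)
      then have "x\<^sup>2 + 1 \<noteq> 0" by simp
      then show ?thesis by (metis of_real_1 of_real_add of_real_eq_0_iff of_real_power)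
    qed
    have "eval_at f t = 0"
    proof (rule vanishing_ideal_eval[OF f _ _ _ t_def])
      show "(a j)\<^sup>2 + (b j)\<^sup>2 \<noteq> 0" for j
        using real_nz nz by (auto simp: a_def b_def)
      have "(\<Sum>j<h. a j * b j / ((a j)\<^sup>2 + (b j)\<^sup>2)) = of_real (\<Sum>j<h. \<rho> j L / (1 + (\<rho> j L)\<^sup>2))"
        by (simp add: a_def b_def add.commute)
      then show "(\<Sum>j<h + 2. a j * b j / ((a j)\<^sup>2 + (b j)\<^sup>2)) = 0"
        unfolding split using sum1 by (simp add: a_def b_def add.assoc)
      have "(\<Sum>j<h. ((a j)\<^sup>2 - (b j)\<^sup>2) / ((a j)\<^sup>2 + (b j)\<^sup>2))
          = (\<Sum>j<h. - of_real ((1 - (\<rho> j L)\<^sup>2) / (1 + (\<rho> j L)\<^sup>2)))"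
        by (intro sum.cong refl) (simp add: a_def b_def add.commute minus_divide_left del: divide_minus_left)
      also have "\<dots> = - of_real (\<Sum>j<h. (1 - (\<rho> j L)\<^sup>2) / (1 + (\<rho> j L)\<^sup>2))"
        by (simp only: sum_negf of_real_sum)
      finally have small_sum: "(\<Sum>j<h. ((a j)\<^sup>2 - (b j)\<^sup>2) / ((a j)\<^sup>2 + (b j)\<^sup>2))
          = - of_real (\<Sum>j<h. (1 - (\<rho> j L)\<^sup>2) / (1 + (\<rho> j L)\<^sup>2))" .
      show "(\<Sum>j<h + 2. ((a j)\<^sup>2 - (b j)\<^sup>2) / ((a j)\<^sup>2 + (b j)\<^sup>2)) = 0"
        unfolding split small_sum sum2[symmetric] by (simp add: a_def b_def)
      show "t \<noteq> 0\<^sub>v (d + 1)"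
        using td W_pos[of d] by (auto dest!: arg_cong[where f = "\<lambda>v. v $ d"])
    qed
    moreover have "norm (t $ i) \<le> (real h + M) * W i" if i: "i \<le> d" for i
    proof (cases "i = d")
      case True
      have "1 \<le> real h + M" using h by (simp add: M_def add_increasing2)
      then have "1 * W d \<le> (real h + M) * W d" using W_pos[of d] by (intro mult_right_mono) auto
      then show ?thesis unfolding True td using W_pos[of d] by simp
    next
      case False
      have "norm (t $ i) \<le> T i + norm (u (d - i))"
        unfolding t[OF i] using T_nonneg[of i] norm_triangle_ineq[of "of_real (T i)" "u (d - i)"] by simp
      also have "\<dots> \<le> real h * W i + M * W (d - 1)"
        using T_le[OF i] u_bound[of "d - i"] by simp
      also have "\<dots> \<le> real h * W i + M * W i"
        using False i by (intro add_left_mono mult_left_mono W_mono) (auto simp: M_def)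
      finally show ?thesis by (simp add: algebra_simps)
    qed
    moreover have "W i / 2 \<le> norm (t $ i)"
      if i: "i \<le> d" "i = d \<or> i = d - 1 \<or> (\<exists>j<h. i = \<beta> j \<or> i = Suc (\<beta> j))" for i
    proof (cases "i = d \<or> i = d - 1")
      case True
      then show ?thesis using td td1 W_pos[of i] by auto
    next
      case False
      then obtain j where j: "j < h" "i = \<beta> j \<or> i = Suc (\<beta> j)" using i(2) by blast
      have i2: "i \<le> d - 2" using False i(1) by arith
      \<comment> \<open>All summands of \<open>T i\<close> are positive, so nothing cancels, and the
        tangent that touches \<open>w\<close> at \<open>i\<close> alone contributes
        \<open>W i\<close>.\<close>
      have "W i = \<psi> j i" using \<psi>_eq[OF j(2)] by simp
      also have "\<dots> \<le> T i"
        unfolding T_def using j(1) \<psi>_pos by (intro member_le_sum) (auto simp: less_imp_le)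
      finally have T: "W i \<le> T i" .
      have "Suc (d - 2) = d - 1" using d by simp
      then have "W (d - 1) = exp (- (L * \<delta> (d - 2))) * W (d - 2)"
        unfolding W_def \<delta>_def by (simp add: algebra_simps flip: exp_add)
      then have "M * W (d - 1) = (exp (- (L * \<delta> (d - 2))) * M) * W (d - 2)" by simp
      also have "\<dots> \<le> 1 / 2 * W (d - 2)"
        using elim(2) W_pos[of "d - 2"] by (intro mult_right_mono) auto
      also have "\<dots> \<le> 1 / 2 * W i" using W_mono[OF i2] by simp
      finally have u: "norm (u (d - i)) \<le> W i / 2" using u_bound[of "d - i"] by simp
      have "T i - norm (u (d - i)) \<le> norm (t $ i)"
        unfolding t[OF i(1)] using norm_diff_ineq[of "of_real (T i)" "u (d - i)"] T_nonneg[of i] by simp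
      then show ?thesis using T u by simp
    qed
    ultimately show ?case unfolding W_def M_def by blast
  qed
qed

section \<open>Leading monomials of the vanishing ideal\<close>

text \<open>Greedy choice: take the least element \<open>b\<close>, discard \<open>b\<close> and
  \<open>b + 1\<close>, and recurse. The chosen elements either form a chain of length
  \<open>n + 1\<close> or run out, and then the discarded pairs cover \<open>S\<close>.\<close>

lemma spaced_chain_or_cover:
  fixes S :: "nat set"
  assumes "finite S"
  shows "(\<exists>a. (\<forall>k\<le>n. a k \<in> S) \<and> (\<forall>k<n. a k + 2 \<le> a (Suc k))) \<or>
    (\<exists>B\<subseteq>S. card B \<le> n \<and> S \<subseteq> B \<union> Suc ` B)"
  using assms
proof (induction n arbitrary: S)
  case 0
  then show ?case by (cases "S = {}") auto
next
  case (Suc n)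
  show ?case
  proof (cases "S = {}")
    case False
    define b where "b = Min S"
    have b: "b \<in> S" "\<And>s. s \<in> S \<Longrightarrow> b \<le> s" using False Suc.prems by (auto simp: b_def)
    define S' where "S' = {s \<in> S. b + 2 \<le> s}"
    have "finite S'" using Suc.prems by (simp add: S'_def)
    from Suc.IH[OF this] show ?thesis
    proof
      assume "\<exists>a. (\<forall>k\<le>n. a k \<in> S') \<and> (\<forall>k<n. a k + 2 \<le> a (Suc k))"
      then obtain a where a: "\<And>k. k \<le> n \<Longrightarrow> a k \<in> S'" "\<And>k. k < n \<Longrightarrow> a k + 2 \<le> a (Suc k)" by blast
      have "\<forall>k\<le>Suc n. case_nat b a k \<in> S" using a(1) b(1) by (auto simp: S'_def split: nat.splits)
      moreover have "\<forall>k<Suc n. case_nat b a k + 2 \<le> case_nat b a (Suc k)"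
        using a by (auto simp: S'_def split: nat.splits)
      ultimately show ?thesis by blast
    next
      assume "\<exists>B\<subseteq>S'. card B \<le> n \<and> S' \<subseteq> B \<union> Suc ` B"
      then obtain B where B: "B \<subseteq> S'" "card B \<le> n" "S' \<subseteq> B \<union> Suc ` B" by blast
      have "s \<in> insert b B \<union> Suc ` insert b B" if "s \<in> S" for s
      proof -
        have "s = b \<or> s = Suc b \<or> s \<in> S'" using b(2)[OF that] that by (auto simp: S'_def)
        then show ?thesis using B(3) by auto
      qed
      moreover have "insert b B \<subseteq> S" using B(1) b(1) by (auto simp: S'_def)
      moreover have "card (insert b B) \<le> Suc n" 
        using B(2) finite_subset[OF B(1) \<open>finite S'\<close>] by (auto simp: card_insert_if)
      ultimately show ?thesis by blast
    qed
  qed auto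
qed

section \<open>Weights that induce the lexicographic order\<close>

lemma weighted_tail_less:
  fixes D :: nat
  assumes "k \<le> d"
  shows "(\<Sum>i\<in>{k<..d}. D * (D + 2) ^ (d - i)) < (D + 2) ^ (d - k)"
  using assms
proof (induction k rule: inc_induct)
  case (step k)
  have "{k<..d} = insert (Suc k) {Suc k<..d}" using step by auto
  then have "(\<Sum>i\<in>{k<..d}. D * (D + 2) ^ (d - i))
      = D * (D + 2) ^ (d - Suc k) + (\<Sum>i\<in>{Suc k<..d}. D * (D + 2) ^ (d - i))" by simp
  also have "\<dots> < D * (D + 2) ^ (d - Suc k) + (D + 2) ^ (d - Suc k)" using step.IH by simp
  also have "\<dots> \<le> (D + 2) ^ Suc (d - Suc k)" by simp
  finally show ?case using step by (simp add: Suc_diff_Suc)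
qed simp

text \<open>The exponents act as digits in base \<open>D + 2\<close>. At the first difference
  \<open>m\<close> gains at least one unit, and all later digits of \<open>m'\<close>, being at most
  \<open>D\<close>, weigh less than that unit.\<close>

lemma lex_less_imp_weight_less:
  fixes m m' :: "nat \<Rightarrow>\<^sub>0 nat"
  assumes "m' < m" "keys m \<subseteq> {..d}" "\<And>i. lookup m' i \<le> D"
  shows "(\<Sum>i\<le>d. lookup m' i * (D + 2) ^ (d - i)) < (\<Sum>i\<le>d. lookup m i * (D + 2) ^ (d - i))"
proof -
  obtain k where k: "lookup m' k < lookup m k" "\<And>i. i < k \<Longrightarrow> lookup m' i = lookup m i"
    using assms(1) unfolding lex_order_iff by blast
  have "k \<in> keys m" using k(1) by (simp add: in_keys_iff)
  then have kd: "k \<le> d" using assms(2) by blast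
  have "{..d} = {..<k} \<union> ({k} \<union> {k<..d})" using kd by auto
  then have split: "(\<Sum>i\<le>d. F i) = (\<Sum>i<k. F i) + (F k + (\<Sum>i\<in>{k<..d}. F i))" for F :: "nat \<Rightarrow> nat"
    by (simp only:) (subst sum.union_disjoint; auto)
  have "(\<Sum>i\<in>{k<..d}. lookup m' i * (D + 2) ^ (d - i)) \<le> (\<Sum>i\<in>{k<..d}. D * (D + 2) ^ (d - i))"
    using assms(3) by (intro sum_mono mult_right_mono) auto
  also have "\<dots> < (D + 2) ^ (d - k)" by (rule weighted_tail_less[OF kd])
  finally have "lookup m' k * (D + 2) ^ (d - k) + (\<Sum>i\<in>{k<..d}. lookup m' i * (D + 2) ^ (d - i))
      < Suc (lookup m' k) * (D + 2) ^ (d - k)" by simp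
  also have "\<dots> \<le> lookup m k * (D + 2) ^ (d - k)"
    using k(1) by (intro mult_right_mono) auto
  finally show ?thesis unfolding split using k(2) by simp
qed

lemma prod_power_exp:
  fixes K L :: real and w :: "nat \<Rightarrow> real" and n :: "nat \<Rightarrow> nat"
  shows "(\<Prod>i\<le>d. (K * exp (L * w i)) ^ n i) = K ^ (\<Sum>i\<le>d. n i) * exp (L * (\<Sum>i\<le>d. real (n i) * w i))"
proof -
  have "(K * exp (L * w i)) ^ n i = K ^ n i * exp (L * (real (n i) * w i))" for i
    by (simp add: power_mult_distrib mult.left_commute flip: exp_of_nat_mult)
  then show ?thesis
    by (simp add: prod.distrib power_sum exp_sum sum_distrib_left)
qed

lemma leading_monomial_not_covered:
  assumes r: "r \<ge> 3" and d: "d \<ge> 2 * r - 2"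
    and f: "f \<in> vanishing_ideal d (fradeco_variety r d)" "f \<noteq> 0"
    and B: "B \<subseteq> {..d - 2}" "card B \<le> r - 2"
    and cover: "keys (Max (keys f)) \<inter> {..d - 2} \<subseteq> B \<union> Suc ` B"
  shows False
proof -
  define h where "h = r - 2"
  have h: "r = h + 2" "h \<ge> 1" "d \<ge> 2" using r d by (auto simp: h_def)
  define m where "m = Max (keys f)"
  have m: "m \<in> keys f" "\<And>m'. m' \<in> keys f \<Longrightarrow> m' \<le> m" using f(2) by (auto simp: m_def)
  have keys_d: "keys m' \<subseteq> {..d}" if "m' \<in> keys f" for m'
    using f(1) that by (auto simp: vanishing_ideal_def poly_ring_def unknowns_def)

  \<comment> \<open>The curve requires exactly \<open>h\<close> edges. Extra edges only add lower
    bounds, so \<open>B\<close> is padded arbitrarily.\<close>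
  have "h \<le> card {..d - 2}" using d r by (simp add: h_def)
  then obtain B' where B': "B \<subseteq> B'" "B' \<subseteq> {..d - 2}" "card B' = h"
    using exists_subset_between[OF B(2)[folded h_def] _ B(1)] by auto
  have "finite B'" using B'(2) finite_subset by blast
  then obtain \<beta> where \<beta>: "bij_betw \<beta> {0..<h} B'"
    using ex_bij_betw_nat_finite B'(3) by blast
  have \<beta>_inj: "inj_on \<beta> {..<h}" and \<beta>_image: "\<beta> ` {..<h} = B'"
    using \<beta> by (auto simp: bij_betw_def atLeast0LessThan)
  have \<beta>_le: "\<beta> j + 2 \<le> d" if "j < h" for j
  proof -
    have "\<beta> j \<in> B'" using \<beta>_image that by blast
    then show ?thesis using B'(2) h(3) by auto
  qed

  define D where "D = (\<Sum>m'\<in>keys f. \<Sum>i\<in>keys m'. lookup m' i)"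
  have D: "lookup m' i \<le> D" if "m' \<in> keys f" for m' i
  proof (cases "i \<in> keys m'")
    case True
    then have "lookup m' i \<le> (\<Sum>i\<in>keys m'. lookup m' i)" by (intro member_le_sum) auto
    also have "\<dots> \<le> D" unfolding D_def using that by (intro member_le_sum[of m']) auto
    finally show ?thesis .
  qed (simp add: in_keys_iff)
  \<comment> \<open>Since \<open>D\<close> bounds every exponent in \<open>f\<close>, these weights
    single out the leading monomial. Powers of a base greater than 1 are also strictly decreasing
    and strictly convex in \<open>i\<close>.\<close>
  define w :: "nat \<Rightarrow> real" where "w i = real (D + 2) ^ (d - i)" for i
  have w_gap: "w i - w (Suc i) = (real D + 1) * real (D + 2) ^ (d - Suc i)" if "i < d" for i
    using that unfolding w_def by (simp add: Suc_diff_Suc[symmetric] algebra_simps)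
  have decreasing: "w (Suc i) < w i" if "i < d" for i
  proof -
    have "0 < (real D + 1) * real (D + 2) ^ (d - Suc i)" by simp
    then show ?thesis using w_gap[OF that] by linarith
  qed
  have convex: "w (Suc i) - w (Suc (Suc i)) < w i - w (Suc i)" if "Suc i < d" for i
    using that w_gap[of i] w_gap[of "Suc i"] by (simp add: power_strict_increasing)

  define wt where "wt m' = (\<Sum>i\<le>d. real (lookup m' i) * w i)" for m'
  define deg where "deg m' = (\<Sum>i\<le>d. lookup m' i)" for m' :: "nat \<Rightarrow>\<^sub>0 nat"
  have wt_less: "wt m' < wt m" if "m' \<in> keys f - {m}" for m'
  proof -
    have "m' < m" using m(2)[of m'] that by auto
    then have "(\<Sum>i\<le>d. lookup m' i * (D + 2) ^ (d - i)) < (\<Sum>i\<le>d. lookup m i * (D + 2) ^ (d - i))"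
      using that by (intro lex_less_imp_weight_less keys_d[OF m(1)] D) auto
    then have "real (\<Sum>i\<le>d. lookup m' i * (D + 2) ^ (d - i)) < real (\<Sum>i\<le>d. lookup m i * (D + 2) ^ (d - i))"
      by (simp only: of_nat_less_iff)
    then show ?thesis unfolding wt_def w_def by (simp only: of_nat_sum of_nat_mult of_nat_power)
  qed
  define K where "K = real h + 2 ^ d * (1 + real h)"
  \<comment> \<open>After division by \<open>exp (L * wt m)\<close>, the leading term is at least
    \<open>c\<close> and the other terms together are at most \<open>g L\<close>, which tends to
    0.\<close>
  define c where "c = norm (lookup f m) * (1 / 2) ^ deg m"
  define g where "g L = (\<Sum>m'\<in>keys f - {m}. norm (lookup f m') * K ^ deg m' * exp (- (L * (wt m - wt m'))))" for L
  have "eventually (\<lambda>L. c \<le> g L) at_top"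
    using degenerating_tensors[where w = w and \<beta> = \<beta>, OF f(1)[unfolded h(1)] h(2,3) decreasing convex \<beta>_inj \<beta>_le]
  proof (rule eventually_mono)
    fix L
    assume "\<exists>t. eval_at f t = 0 \<and>
      (\<forall>i\<le>d. norm (t $ i) \<le> (real h + 2 ^ d * (1 + real h)) * exp (L * w i)) \<and>
      (\<forall>i\<le>d. i = d \<or> i = d - 1 \<or> (\<exists>j<h. i = \<beta> j \<or> i = Suc (\<beta> j)) \<longrightarrow>
        exp (L * w i) / 2 \<le> norm (t $ i))"
    then obtain t where t0: "eval_at f t = 0"
      and upper: "\<And>i. i \<le> d \<Longrightarrow> norm (t $ i) \<le> K * exp (L * w i)"
      and lower: "\<And>i. i \<le> d \<Longrightarrow> i = d \<or> i = d - 1 \<or> (\<exists>j<h. i = \<beta> j \<or> i = Suc (\<beta> j)) \<Longrightarrow>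
        exp (L * w i) / 2 \<le> norm (t $ i)"
      unfolding K_def by blast
    have norm_monomial: "norm (monomial_at m' (($) t)) = (\<Prod>i\<le>d. norm (t $ i) ^ lookup m' i)"
      if "m' \<in> keys f" for m'
      by (simp add: monomial_at_superset[OF _ keys_d[OF that]] norm_power flip: prod_norm)
    have above: "norm (monomial_at m' (($) t)) \<le> K ^ deg m' * exp (L * wt m')" if "m' \<in> keys f" for m'
      unfolding norm_monomial[OF that] deg_def wt_def prod_power_exp[symmetric]
      using upper by (intro prod_mono) (auto intro!: power_mono)
    have below: "(1 / 2) ^ deg m * exp (L * wt m) \<le> norm (monomial_at m (($) t))"
      unfolding norm_monomial[OF m(1)] deg_def wt_def prod_power_exp[symmetric]
    proof (intro prod_mono conjI)
      fix i assume "i \<in> {..d}"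
      then have i: "i \<le> d" by simp
      show "(1 / 2 * exp (L * w i)) ^ lookup m i \<le> norm (t $ i) ^ lookup m i"
      proof (cases "i \<in> keys m")
        case True
        have "i = d \<or> i = d - 1 \<or> i \<in> keys m \<inter> {..d - 2}" using True i by auto
        then have "i = d \<or> i = d - 1 \<or> i \<in> B' \<union> Suc ` B'"
          using cover[folded m_def] B'(1) by blast
        then have "i = d \<or> i = d - 1 \<or> (\<exists>j<h. i = \<beta> j \<or> i = Suc (\<beta> j))"
          unfolding \<beta>_image[symmetric] by blast
        then show ?thesis using lower[OF i] by (intro power_mono) auto
      qed (simp add: in_keys_iff)
    qed simp
    have "0 = lookup f m * monomial_at m (($) t) + (\<Sum>m'\<in>keys f - {m}. lookup f m' * monomial_at m' (($) t))"
      using t0 eval_at_superset[of "keys f" f t] m(1) by (simp add: sum.remove[OF finite_keys m(1)])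
    then have "lookup f m * monomial_at m (($) t) = - (\<Sum>m'\<in>keys f - {m}. lookup f m' * monomial_at m' (($) t))"
      by (simp add: eq_neg_iff_add_eq_0)
    then have "norm (lookup f m) * norm (monomial_at m (($) t))
        = norm (\<Sum>m'\<in>keys f - {m}. lookup f m' * monomial_at m' (($) t))"
      by (metis norm_minus_cancel norm_mult)
    also have "\<dots> \<le> (\<Sum>m'\<in>keys f - {m}. norm (lookup f m') * (K ^ deg m' * exp (L * wt m')))"
      by (rule sum_norm_le) (auto simp: norm_mult intro!: mult_left_mono above)
    finally have "norm (lookup f m) * ((1 / 2) ^ deg m * exp (L * wt m))
        \<le> (\<Sum>m'\<in>keys f - {m}. norm (lookup f m') * (K ^ deg m' * exp (L * wt m')))"
      using mult_left_mono[OF below norm_ge_zero[of "lookup f m"]] by linarith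
    then have "c * exp (L * wt m) * exp (- (L * wt m))
        \<le> (\<Sum>m'\<in>keys f - {m}. norm (lookup f m') * (K ^ deg m' * exp (L * wt m'))) * exp (- (L * wt m))"
      unfolding c_def by (intro mult_right_mono) (simp_all add: mult.assoc)
    also have "\<dots> = g L"
      unfolding g_def sum_distrib_right
      by (intro sum.cong refl) (simp add: algebra_simps flip: exp_add)
    also have "c * exp (L * wt m) * exp (- (L * wt m)) = c"
      by (simp add: mult.assoc flip: exp_add)
    finally show "c \<le> g L" .
  qed
  moreover have "(g \<longlongrightarrow> (\<Sum>m'\<in>keys f - {m}. norm (lookup f m') * K ^ deg m' * 0)) at_top"
    unfolding g_def using wt_less by (intro tendsto_intros tendsto_exp_decay) simp
  ultimately have "c \<le> 0"
    by (auto intro: tendsto_lowerbound)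
  moreover have "c > 0" unfolding c_def using m(1) by (simp add: in_keys_iff)
  ultimately show False by simp
qed

section \<open>Minors with a prescribed leading monomial\<close>

lemma pick_image_strict_mono:
  assumes s: "\<And>i j. i < j \<Longrightarrow> j < n \<Longrightarrow> s i < (s j :: nat)" and "k < n"
  shows "pick (s ` {..<n}) k = s k"
proof -
  have less_iff: "s i < s k \<longleftrightarrow> i < k" if "i < n" for i
    using s[of i k] s[of k i] assms(2) that by (metis less_asym less_irrefl nat_neq_iff)
  then have "{a \<in> s ` {..<n}. a < s k} = s ` {..<k}" using assms(2) by auto
  moreover have "inj_on s {..<k}"
    using s assms(2) by (intro linorder_inj_onI nat_le_linear) (metis lessThan_iff less_irrefl less_trans)
  ultimately have "card {a \<in> s ` {..<n}. a < s k} = k" by (simp add: card_image)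
  then show ?thesis using pick_card_in_set[of "s k" "s ` {..<n}"] assms(2) by simp
qed

lemma leads_with_fradeco_minor:
  assumes r: "r \<in> {3..9}" and J: "J \<subseteq> {..<d - r + 1}" "card J = r - 1"
  obtains c where "c \<noteq> 0" "leads_with (det (submatrix (fradeco_matrix r d) UNIV J))
    (\<Sum>k=0..<r - 1. single (k + pick J k) 1) c"
proof
  show "leads_with (det (submatrix (fradeco_matrix r d) UNIV J)) (\<Sum>k=0..<r - 1. single (k + pick J k) 1)
      (signof (pivot r) * (\<Prod>i=0..<r - 1. row_coeff r i (pivot r i)))"
  proof (rule leads_with_det_shifted_forms[OF fradeco_submatrix(1)[OF r J]])
    show "pivot r i \<le> r" if "i < r - 1" for i
      using permutes_in_image[OF pivot_permutes[OF r], of i] that by simp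
  qed (use fradeco_submatrix(3)[OF r J] pivot_permutes[OF r] row_coeff_pivot(2)[OF r] J(2) in \<open>auto intro: pick_mono_le\<close>)
  show "signof (pivot r) * (\<Prod>i=0..<r - 1. row_coeff r i (pivot r i)) \<noteq> 0"
    using row_coeff_pivot(1)[OF r] by (simp add: prod_zero_iff sign_def)
qed

lemma chain_monomial_divides:
  fixes m :: "nat \<Rightarrow>\<^sub>0 nat" and a :: "nat \<Rightarrow> nat"
  assumes "\<And>i j. i < j \<Longrightarrow> j < n \<Longrightarrow> a i < a j" "\<And>k. k < n \<Longrightarrow> a k \<in> keys m"
  obtains b where "m = (\<Sum>k=0..<n. single (a k) 1) + b"
proof -
  have "lookup (\<Sum>k=0..<n. single (a k) (1::nat)) x \<le> lookup m x" for x
  proof (cases "x \<in> a ` {0..<n}")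
    case True
    then obtain k where k: "k < n" "x = a k" by auto
    have "a i = a k \<longleftrightarrow> i = k" if "i < n" for i
      using assms(1)[of i k] assms(1)[of k i] that k(1) by (cases i k rule: linorder_cases) auto
    then have "lookup (\<Sum>k=0..<n. single (a k) (1::nat)) x = (\<Sum>i=0..<n. if i = k then 1 else 0)"
      unfolding lookup_sum lookup_single when_def k(2) by (intro sum.cong) auto
    also have "\<dots> = 1" using k(1) by simp
    also have "1 \<le> lookup m x" using assms(2)[OF k(1)] k(2) by (simp add: in_keys_iff)
    finally show ?thesis .
  next
    case False
    then have "lookup (\<Sum>k=0..<n. single (a k) (1::nat)) x = 0"
      unfolding lookup_sum lookup_single when_def by (intro sum.neutral) auto
    then show ?thesis by simp
  qed
  then have "m = (\<Sum>k=0..<n. single (a k) 1) + (m - (\<Sum>k=0..<n. single (a k) 1))"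
    by (intro poly_mapping_eqI) (simp add: lookup_add minus_poly_mapping.rep_eq)
  then show thesis by (rule that)
qed

text \<open>If no \<open>r - 2\<close> adjacent pairs cover the support below \<open>d - 1\<close>,
  it contains \<open>r - 1\<close> pairwise nonadjacent indices \<open>a k\<close>. A minor is then
  chosen whose leading monomial is the product of exactly these unknowns.\<close>

lemma leading_monomial_divisible:
  assumes r: "r \<in> {3..9}" and d: "d \<ge> 2 * r - 2"
    and f: "f \<in> vanishing_ideal d (fradeco_variety r d)" "f \<noteq> 0"
  obtains g b where "g \<in> maximal_minors (fradeco_matrix r d)" "g \<noteq> 0" "Max (keys f) = Max (keys g) + b"
proof -
  let ?S = "keys (Max (keys f)) \<inter> {..d - 2}"
  have "\<not> (\<exists>B\<subseteq>?S. card B \<le> r - 2 \<and> ?S \<subseteq> B \<union> Suc ` B)"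
  proof
    assume "\<exists>B\<subseteq>?S. card B \<le> r - 2 \<and> ?S \<subseteq> B \<union> Suc ` B"
    then obtain B where "B \<subseteq> ?S" "card B \<le> r - 2" "?S \<subseteq> B \<union> Suc ` B" by blast
    then show False using leading_monomial_not_covered[OF _ d f, of B] r by auto
  qed
  then obtain a where a: "\<And>k. k \<le> r - 2 \<Longrightarrow> a k \<in> ?S" "\<And>k. k < r - 2 \<Longrightarrow> a k + 2 \<le> a (Suc k)"
    using spaced_chain_or_cover[of ?S "r - 2"] by auto
  \<comment> \<open>Leading indices of a minor are column plus position, so \<open>s k\<close> is
    the column wanted. Gaps of at least 2 in \<open>a\<close> become strict growth of
    \<open>s\<close>.\<close>
  define s where "s k = a k - k" for k
  have a_ge: "k \<le> a k" if "k \<le> r - 2" for k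
    using that
  proof (induction k)
    case (Suc k)
    then show ?case using a(2)[of k] by simp
  qed simp
  have a_eq: "a k = k + s k" if "k \<le> r - 2" for k using a_ge[OF that] by (simp add: s_def)
  have s_step: "s k < s (Suc k)" if "k < r - 2" for k
    using a(2)[OF that] a_eq[of k] a_eq[of "Suc k"] that by simp
  have s_less: "s i < s j" if "i < j" "j < r - 1" for i j
    using that
  proof (induction j)
    case (Suc j)
    then have "j < r - 2" by simp
    then show ?case using Suc s_step[of j] by (cases "i = j") auto
  qed simp
  \<comment> \<open>From \<open>a (r - 2) \<le> d - 2\<close> it follows that
    \<open>s (r - 2) \<le> d - r\<close>, the last column.\<close>
  have "s k < d - r + 1" if "k < r - 1" for k
  proof -
    have "k < r - 2 \<or> k = r - 2" using that by arith
    moreover have "r - 2 < r - 1" using r by auto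
    ultimately have "s k \<le> s (r - 2)" using s_less[of k "r - 2"] by auto
    moreover have "s (r - 2) + (r - 2) \<le> d - 2" using a(1)[of "r - 2"] a_eq[of "r - 2"] by simp
    ultimately show ?thesis using r d by auto
  qed
  define J where "J = s ` {..<r - 1}"
  have J: "J \<subseteq> {..<d - r + 1}" using \<open>\<And>k. k < r - 1 \<Longrightarrow> s k < d - r + 1\<close> by (auto simp: J_def)
  have "inj_on s {..<r - 1}"
    using s_less by (intro linorder_inj_onI nat_le_linear) (metis lessThan_iff less_irrefl)
  then have cJ: "card J = r - 1" by (simp add: J_def card_image)
  let ?g = "det (submatrix (fradeco_matrix r d) UNIV J)"
  obtain c where c: "c \<noteq> 0" "leads_with ?g (\<Sum>k=0..<r - 1. single (k + pick J k) 1) c"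
    using leads_with_fradeco_minor[OF r J cJ] by blast
  have "(\<Sum>k=0..<r - 1. single (k + pick J k) (1::nat)) = (\<Sum>k=0..<r - 1. single (a k) 1)"
    using pick_image_strict_mono[of "r - 1" s] s_less a_eq by (intro sum.cong) (auto simp: J_def)
  then have g: "?g \<noteq> 0" "Max (keys ?g) = (\<Sum>k=0..<r - 1. single (a k) 1)"
    using leads_with_Max[OF c(2,1)] by simp_all
  have "a i < a j" if "i < j" "j < r - 1" for i j
    using s_less[OF that] a_eq[of i] a_eq[of j] that by simp
  then obtain b where "Max (keys f) = (\<Sum>k=0..<r - 1. single (a k) 1) + b"
    using chain_monomial_divides[of "r - 1" a "Max (keys f)"] a(1) by auto
  moreover have "?g \<in> maximal_minors (fradeco_matrix r d)"
    unfolding maximal_minors_def fradeco_matrix_dim using J cJ by blast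
  ultimately show thesis using that g by metis
qed

section \<open>Ideal membership and assembly\<close>

lemma shifted_form_carrier: "r + j \<le> d \<Longrightarrow> shifted_form a r j \<in> carrier (poly_ring d)"
  by (auto simp: poly_ring_def unknowns_shifted_form)

text \<open>A minor is homogeneous, so its zero set is closed. It contains the tensors of frames and
  hence their closure.\<close>

lemma minors_in_vanishing_ideal:
  assumes r: "r \<in> {3..9}" and d: "r \<le> d"
  shows "maximal_minors (fradeco_matrix r d) \<subseteq> vanishing_ideal d (fradeco_variety r d)"
proof
  fix g assume "g \<in> maximal_minors (fradeco_matrix r d)"
  then obtain J where g: "g = det (submatrix (fradeco_matrix r d) UNIV J)"
    and J: "J \<subseteq> {..<d - r + 1}" "card J = r - 1"
    by (auto simp: maximal_minors_def fradeco_matrix_dim)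
  note S = fradeco_submatrix[OF r J]
  have carrier: "g \<in> carrier (poly_ring d)"
    unfolding g
  proof (rule ring_det_closed)
    fix i j assume "i < dim_row (submatrix (fradeco_matrix r d) UNIV J)" "j < dim_col (submatrix (fradeco_matrix r d) UNIV J)"
    then have ij: "i < r - 1" "j < r - 1" using S(1) by auto
    then have "r + pick J j \<le> d" using S(2)[of j] d by simp
    then show "submatrix (fradeco_matrix r d) UNIV J $$ (i, j) \<in> carrier (poly_ring d)"
      unfolding S(3)[OF ij] by (rule shifted_form_carrier)
  qed
  have homogeneous: "homogeneous (r - 1) g"
    unfolding g by (rule homogeneous_det[OF S(1)]) (simp only: S(3) homogeneous_shifted_form)
  let ?Z = "{P \<in> proj_space d. \<forall>f\<in>{g}. vanishes_at f P}"
  have "zariski_closed d ?Z"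
    unfolding zariski_closed_def using carrier homogeneous by (intro exI[of _ "{g}"]) auto
  moreover have "{proj_point (binary_coords d (frame_tensor V lam)) | V lam.
       V \<in> funtf_variety r 2 \<and> binary_coords d (frame_tensor V lam) \<noteq> 0\<^sub>v (d + 1)} \<subseteq> ?Z"
  proof clarify
    fix V lam
    let ?t = "binary_coords d (frame_tensor V lam)"
    assume V: "V \<in> funtf_variety r 2" and nz: "?t \<noteq> 0\<^sub>v (d + 1)"
    have "?t \<in> carrier_vec (d + 1)" by (simp add: binary_coords_def)
    then have "proj_point ?t \<in> proj_space d" using nz by (simp add: proj_space_def)
    \<comment> \<open>A projective point consists of all nonzero multiples of a vector, and the
      scalar is absorbed into \<open>lam\<close>.\<close>
    moreover have "eval_at g (c \<cdot>\<^sub>v ?t) = 0" for c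
      unfolding g
    proof (rule minor_vanishes_on_frames[OF r d V J])
      fix i assume i: "i \<le> d"
      have "V \<in> carrier_mat 2 r" using V by (simp add: funtf_variety_def)
      from binary_coords_frame_tensor[OF this i, of lam]
      show "(c \<cdot>\<^sub>v ?t) $ i = (\<Sum>k<r. (c * lam k) * (V $$ (0, k)) ^ i * (V $$ (1, k)) ^ (d - i))"
        using i by (simp add: binary_coords_def sum_distrib_left mult.assoc)
    qed
    ultimately show "proj_point ?t \<in> proj_space d \<and> (\<forall>f\<in>{g}. vanishes_at f (proj_point ?t))"
      by (auto simp: vanishes_at_def proj_point_def)
  qed
  ultimately have "fradeco_variety r d \<subseteq> ?Z"
    unfolding fradeco_variety_def by (intro hull_minimal)
  then show "g \<in> vanishing_ideal d (fradeco_variety r d)"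
    using carrier by (auto simp: vanishing_ideal_def)
qed

lemma groebner_basis_fradeco_minors:
  assumes r: "r \<in> {3..9}" and d: "d \<ge> 2 * r - 2"
  shows "is_groebner_basis d (maximal_minors (fradeco_matrix r d)) (vanishing_ideal d (fradeco_variety r d))"
proof -
  let ?G = "maximal_minors (fradeco_matrix r d)" and ?I = "vanishing_ideal d (fradeco_variety r d)"
  have rd: "r \<le> d" using r d by auto
  have G: "?G \<subseteq> ?I" by (rule minors_in_vanishing_ideal[OF r rd])
  have "?G \<subseteq> (\<lambda>J. det (submatrix (fradeco_matrix r d) UNIV J)) ` Pow {..<d - r + 1}"
    by (auto simp: maximal_minors_def fradeco_matrix_dim)
  then have "finite ?G" by (rule finite_subset) simp
  moreover have "initial_ideal d ?G \<subseteq> initial_ideal d ?I"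
    unfolding initial_ideal_def genideal_def using G by blast
  moreover have "initial_ideal d ?I \<subseteq> initial_ideal d ?G"
  proof -
    \<comment> \<open>A generated ideal is the intersection of the ideals \<open>K\<close>
      containing the generators. The cofactor \<open>single b 1\<close> lies in the ring because
      \<open>b\<close> divides a monomial of \<open>f\<close>.\<close>
    have "{initial_monomial f | f. f \<in> ?I \<and> f \<noteq> 0} \<subseteq> K"
      if K: "ideal K (poly_ring d)" "{initial_monomial f | f. f \<in> ?G \<and> f \<noteq> 0} \<subseteq> K" for K
    proof clarify
      fix f assume f: "f \<in> ?I" "f \<noteq> 0"
      obtain g b where g: "g \<in> ?G" "g \<noteq> 0" and b: "Max (keys f) = Max (keys g) + b"
        using leading_monomial_divisible[OF r d f] by blast
      have "Max (keys f) \<in> keys f" using f(2) by simp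
      then have "keys (Max (keys f)) \<subseteq> {..d}"
        using f(1) by (auto simp: vanishing_ideal_def poly_ring_def unknowns_def)
      moreover have "keys b \<subseteq> keys (Max (keys f))" unfolding b by (auto simp: in_keys_iff lookup_add)
      ultimately have "single b 1 \<in> carrier (poly_ring d)"
        by (auto simp: poly_ring_def unknowns_single)
      then have "single b 1 \<otimes>\<^bsub>poly_ring d\<^esub> initial_monomial g \<in> K"
        using K g by (intro ideal.I_l_closed) auto
      then show "initial_monomial f \<in> K"
        by (simp add: poly_ring_def initial_monomial_def mult_single b add.commute)
    qed
    then show ?thesis unfolding initial_ideal_def genideal_def by blast
  qed
  ultimately show ?thesis using G by (simp add: is_groebner_basis_def)
qed

theorem theorem3p1:
  fixes r d :: nat
  assumes "r \<in> {3..9}" and "d \<ge> 2 * r - 2"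
  shows "\<exists>M :: cpoly mat.
    is_groebner_basis d (maximal_minors M) (vanishing_ideal d (fradeco_variety r d)) \<and>
    dim_row M = r - 1 \<and> dim_col M = d - r + 1 \<and>
    (\<forall>i < dim_row M. \<forall>j < dim_col M. linear_form d (M $$ (i, j))) \<and>
    (\<forall>j < dim_col M. card (\<Union>i < dim_row M. unknowns (M $$ (i, j))) = r + 1) \<and>
    (\<forall>i < dim_row M. \<forall>j < dim_col M. M $$ (i, j) = index_shift j (M $$ (i, 0))) \<and>
    M = fradeco_matrix r d"
proof (intro exI[of _ "fradeco_matrix r d"] conjI allI impI refl)
  let ?M = "fradeco_matrix r d"
  note r = assms(1) and dim = fradeco_matrix_dim[of r d]
  have rd: "r \<le> d" using assms by auto
  show "is_groebner_basis d (maximal_minors ?M) (vanishing_ideal d (fradeco_variety r d))"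
    by (rule groebner_basis_fradeco_minors[OF assms])
  show "dim_row ?M = r - 1" "dim_col ?M = d - r + 1" by (rule dim)+
  have entry: "?M $$ (i, j) = shifted_form (row_coeff r i) r j" if "i < dim_row ?M" "j < dim_col ?M" for i j
    using that unfolding dim by (rule fradeco_matrix_entry[OF r])
  show "linear_form d (?M $$ (i, j))" if "i < dim_row ?M" "j < dim_col ?M" for i j
    using that(2) rd unfolding linear_form_def entry[OF that] dim
    by (intro conjI shifted_form_carrier homogeneous_shifted_form) simp
  show "?M $$ (i, j) = index_shift j (?M $$ (i, 0))" if "i < dim_row ?M" "j < dim_col ?M" for i j
    using that entry[of i 0] by (simp add: entry index_shift_shifted_form)
  fix j assume j: "j < dim_col ?M"
  \<comment> \<open>Indices below \<open>r - 1\<close> occur as pivots, the last two by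
    \<open>row_coeff_last\<close>.\<close>
  have occurs: "\<exists>i<r - 1. row_coeff r i l \<noteq> 0" if "l \<le> r" for l
  proof (cases "l < r - 1")
    case True
    then have "l \<in> pivot r ` {0..<r - 1}" using permutes_image[OF pivot_permutes[OF r]] by simp
    then show ?thesis using row_coeff_pivot(1)[OF r] by auto
  next
    case False
    then have "l = r - 1 \<or> l = r" using that by auto
    then show ?thesis using row_coeff_last[OF r] by auto
  qed
  have "(\<Union>i<dim_row ?M. unknowns (?M $$ (i, j)))
      = (\<Union>i<r - 1. (\<lambda>l. l + j) ` {l. l \<le> r \<and> row_coeff r i l \<noteq> 0})"
    using j by (simp add: entry unknowns_shifted_form dim)
  also have "\<dots> = (\<lambda>l. l + j) ` (\<Union>i<r - 1. {l. l \<le> r \<and> row_coeff r i l \<noteq> 0})"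
    by (rule image_UN[symmetric])
  also have "(\<Union>i<r - 1. {l. l \<le> r \<and> row_coeff r i l \<noteq> 0}) = {..r}"
    using occurs by blast
  finally show "card (\<Union>i<dim_row ?M. unknowns (?M $$ (i, j))) = r + 1"
    by (simp add: card_image)
qed

end
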